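(* Let $k$ be a field, let $H$ be a cosemisimple Hopf algebra over $k$, and let $A\subseteq H$ be a Hopf subalgebra. Then $H$ is faithfully flat over $A$ (both as a right $A$-module and as a left $A$-module).
   Context: All Hopf algebras are over a fixed field $k$. A Hopf algebra is cosemisimple if it is the direct sum of its simple subcoalgebras (equivalently, all of its comodules are semisimple). A Hopf subalgebra is a sub-bialgebra stable under the antipode. No finiteness assumptions are made. *)

theory Defs
  imports
    Complex_Main
    "HOL-Library.Poly_Mapping"
    "HOL-Computational_Algebra.Group_Closure"
begin

section \<open>Tensor products over a not necessarily commutative ring\<close>

text \<open>
  The ring is a subset \<open>R\<close> of a type, acting on the right on the type \<open>'m\<close> and on the left on
  the type \<open>'n\<close>; nothing depends on how the actions behave outside \<open>R\<close>.  The tensor product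
  is the free abelian group on \<open>'m \<times> 'n\<close> (finitely supported integer-valued functions) modulo
  the subgroup generated by the usual relators.  Its elements are equivalence classes, and
  operations on classes are written as unions over representatives, in the style of
  \<^theory>\<open>HOL.Equiv_Relations\<close>.
\<close>

definition tensor_relators ::
  "'r set \<Rightarrow> ('m::ab_group_add \<Rightarrow> 'r \<Rightarrow> 'm) \<Rightarrow> ('r \<Rightarrow> 'n::ab_group_add \<Rightarrow> 'n) \<Rightarrow> ('m \<times> 'n \<Rightarrow>\<^sub>0 int) set"
  where "tensor_relators R ract lact =
      {frag_of (x + x', y) - frag_of (x, y) - frag_of (x', y) | x x' y. True}
    \<union> {frag_of (x, y + y') - frag_of (x, y) - frag_of (x, y') | x y y'. True}
    \<union> {frag_of (ract x r, y) - frag_of (x, lact r y) | x r y. r \<in> R}"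

definition tensor_rel ::
  "'r set \<Rightarrow> ('m::ab_group_add \<Rightarrow> 'r \<Rightarrow> 'm) \<Rightarrow> ('r \<Rightarrow> 'n::ab_group_add \<Rightarrow> 'n) \<Rightarrow> ('m \<times> 'n \<Rightarrow>\<^sub>0 int) rel"
  where "tensor_rel R ract lact = {(p, q). p - q \<in> group_closure (tensor_relators R ract lact)}"

definition tensor ::
  "'r set \<Rightarrow> ('m::ab_group_add \<Rightarrow> 'r \<Rightarrow> 'm) \<Rightarrow> ('r \<Rightarrow> 'n::ab_group_add \<Rightarrow> 'n) \<Rightarrow> ('m \<times> 'n \<Rightarrow>\<^sub>0 int) set set"
  where "tensor R ract lact = UNIV // tensor_rel R ract lact"

text \<open>
  The map \<open>f \<otimes> g\<close>; the first argument is the relation defining the target tensor product.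
\<close>

definition tensor_map ::
  "('m' \<times> 'n' \<Rightarrow>\<^sub>0 int) rel \<Rightarrow> ('m \<Rightarrow> 'm') \<Rightarrow> ('n \<Rightarrow> 'n') \<Rightarrow>
   ('m \<times> 'n \<Rightarrow>\<^sub>0 int) set \<Rightarrow> ('m' \<times> 'n' \<Rightarrow>\<^sub>0 int) set"
  where "tensor_map rel' f g t =
    (\<Union>p\<in>t. rel' `` {frag_extend (\<lambda>(x, y). frag_of (f x, g y)) p})"


section \<open>Faithful flatness\<close>

definition left_module :: "'r::ring_1 set \<Rightarrow> ('r \<Rightarrow> 'm::ab_group_add \<Rightarrow> 'm) \<Rightarrow> bool"
  where "left_module R act \<longleftrightarrow>
    (\<forall>r\<in>R. \<forall>x y. act r (x + y) = act r x + act r y) \<and>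
    (\<forall>r\<in>R. \<forall>s\<in>R. \<forall>x. act (r + s) x = act r x + act s x) \<and>
    (\<forall>r\<in>R. \<forall>s\<in>R. \<forall>x. act (r * s) x = act r (act s x)) \<and>
    (\<forall>x. act 1 x = x)"

definition right_module :: "'r::ring_1 set \<Rightarrow> ('m::ab_group_add \<Rightarrow> 'r \<Rightarrow> 'm) \<Rightarrow> bool"
  where "right_module R act \<longleftrightarrow>
    (\<forall>r\<in>R. \<forall>x y. act (x + y) r = act x r + act y r) \<and>
    (\<forall>r\<in>R. \<forall>s\<in>R. \<forall>x. act x (r + s) = act x r + act x s) \<and>
    (\<forall>r\<in>R. \<forall>s\<in>R. \<forall>x. act x (r * s) = act (act x r) s) \<and>
    (\<forall>x. act x 1 = x)"

definition left_module_hom ::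
  "'r set \<Rightarrow> ('r \<Rightarrow> 'm::ab_group_add \<Rightarrow> 'm) \<Rightarrow> ('r \<Rightarrow> 'n::ab_group_add \<Rightarrow> 'n) \<Rightarrow> ('m \<Rightarrow> 'n) \<Rightarrow> bool"
  where "left_module_hom R act act' f \<longleftrightarrow>
    (\<forall>x y. f (x + y) = f x + f y) \<and> (\<forall>r\<in>R. \<forall>x. f (act r x) = act' r (f x))"

definition right_module_hom ::
  "'r set \<Rightarrow> ('m::ab_group_add \<Rightarrow> 'r \<Rightarrow> 'm) \<Rightarrow> ('n::ab_group_add \<Rightarrow> 'r \<Rightarrow> 'n) \<Rightarrow> ('m \<Rightarrow> 'n) \<Rightarrow> bool"
  where "right_module_hom R act act' f \<longleftrightarrow>
    (\<forall>x y. f (x + y) = f x + f y) \<and> (\<forall>r\<in>R. \<forall>x. f (act x r) = act' (f x) r)"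

text \<open>
  A right \<open>R\<close>-module \<open>P\<close> is faithfully flat if a sequence \<open>M1 \<rightarrow> M2 \<rightarrow> M3\<close> of left
  \<open>R\<close>-modules is exact (image equals kernel) exactly when
  \<open>P \<otimes>\<^sub>R M1 \<rightarrow> P \<otimes>\<^sub>R M2 \<rightarrow> P \<otimes>\<^sub>R M3\<close> is.
  A formula cannot quantify over types, so the types underlying the test modules are explicit
  parameters; faithful flatness proper is the assertion for arbitrary type variables.
\<close>

definition faithfully_flat_right ::
  "'m1::ab_group_add itself \<Rightarrow> 'm2::ab_group_add itself \<Rightarrow> 'm3::ab_group_add itself \<Rightarrow>
   'r::ring_1 set \<Rightarrow> ('p::ab_group_add \<Rightarrow> 'r \<Rightarrow> 'p) \<Rightarrow> bool"
  where "faithfully_flat_right _ _ _ R ract \<longleftrightarrow>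
    right_module R ract \<and>
    (\<forall>(act1 :: 'r \<Rightarrow> 'm1 \<Rightarrow> 'm1) (act2 :: 'r \<Rightarrow> 'm2 \<Rightarrow> 'm2) (act3 :: 'r \<Rightarrow> 'm3 \<Rightarrow> 'm3) f g.
      left_module R act1 \<and> left_module R act2 \<and> left_module R act3 \<and>
      left_module_hom R act1 act2 f \<and> left_module_hom R act2 act3 g \<longrightarrow>
      (range f = {x. g x = 0} \<longleftrightarrow>
       tensor_map (tensor_rel R ract act2) id f ` tensor R ract act1 =
       {t \<in> tensor R ract act2.
          tensor_map (tensor_rel R ract act3) id g t = tensor_rel R ract act3 `` {0}}))"

definition faithfully_flat_left ::
  "'m1::ab_group_add itself \<Rightarrow> 'm2::ab_group_add itself \<Rightarrow> 'm3::ab_group_add itself \<Rightarrow>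
   'r::ring_1 set \<Rightarrow> ('r \<Rightarrow> 'p::ab_group_add \<Rightarrow> 'p) \<Rightarrow> bool"
  where "faithfully_flat_left _ _ _ R lact \<longleftrightarrow>
    left_module R lact \<and>
    (\<forall>(act1 :: 'm1 \<Rightarrow> 'r \<Rightarrow> 'm1) (act2 :: 'm2 \<Rightarrow> 'r \<Rightarrow> 'm2) (act3 :: 'm3 \<Rightarrow> 'r \<Rightarrow> 'm3) f g.
      right_module R act1 \<and> right_module R act2 \<and> right_module R act3 \<and>
      right_module_hom R act1 act2 f \<and> right_module_hom R act2 act3 g \<longrightarrow>
      (range f = {x. g x = 0} \<longleftrightarrow>
       tensor_map (tensor_rel R act2 lact) f id ` tensor R act1 lact =
       {t \<in> tensor R act2 lact.
          tensor_map (tensor_rel R act3 lact) g id t = tensor_rel R act3 lact `` {0}}))"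


section \<open>Tensor powers of a vector space\<close>

text \<open>
  A separate locale, since the interpretation of \<^locale>\<open>vector_space\<close> for
  \<^class>\<open>real_vector\<close> would otherwise capture the names below.
\<close>

locale vector_space_tensor = vector_space scale
  for scale :: "'k::field \<Rightarrow> 'b::ab_group_add \<Rightarrow> 'b"
begin

abbreviation rel2 :: "('b \<times> 'b \<Rightarrow>\<^sub>0 int) rel"
  where "rel2 \<equiv> tensor_rel UNIV (\<lambda>x c. scale c x) scale"

abbreviation tensor2 :: "('b \<times> 'b \<Rightarrow>\<^sub>0 int) set set"
  where "tensor2 \<equiv> tensor UNIV (\<lambda>x c. scale c x) scale"

definition plus2 :: "('b \<times> 'b \<Rightarrow>\<^sub>0 int) set \<Rightarrow> ('b \<times> 'b \<Rightarrow>\<^sub>0 int) set \<Rightarrow> ('b \<times> 'b \<Rightarrow>\<^sub>0 int) set"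
  where "plus2 t u = (\<Union>p\<in>t. \<Union>q\<in>u. rel2 `` {p + q})"

definition scale2 :: "'k \<Rightarrow> ('b \<times> 'b \<Rightarrow>\<^sub>0 int) set \<Rightarrow> ('b \<times> 'b \<Rightarrow>\<^sub>0 int) set"
  where "scale2 c = tensor_map rel2 (scale c) id"

text \<open>
  The threefold tensor power, by trilinear relators; it stands for both bracketings.
\<close>

definition relators3 :: "('b \<times> 'b \<times> 'b \<Rightarrow>\<^sub>0 int) set"
  where "relators3 =
      {frag_of (x + x', y, z) - frag_of (x, y, z) - frag_of (x', y, z) | x x' y z. True}
    \<union> {frag_of (x, y + y', z) - frag_of (x, y, z) - frag_of (x, y', z) | x y y' z. True}
    \<union> {frag_of (x, y, z + z') - frag_of (x, y, z) - frag_of (x, y, z') | x y z z'. True}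
    \<union> {frag_of (scale c x, y, z) - frag_of (x, scale c y, z) | c x y z. True}
    \<union> {frag_of (x, scale c y, z) - frag_of (x, y, scale c z) | c x y z. True}"

definition rel3 :: "('b \<times> 'b \<times> 'b \<Rightarrow>\<^sub>0 int) rel"
  where "rel3 = {(p, q). p - q \<in> group_closure relators3}"

text \<open>
  The additive extension of \<open>f\<close> to the free abelian group; for bilinear \<open>f\<close> its value
  depends only on the class in \<^term>\<open>tensor2\<close>.
\<close>

definition eval_frag :: "('b \<times> 'b \<Rightarrow> 'b) \<Rightarrow> ('b \<times> 'b \<Rightarrow>\<^sub>0 int) \<Rightarrow> 'b"
  where "eval_frag f p =
    (\<Sum>z\<in>Poly_Mapping.keys p. scale (of_int (Poly_Mapping.lookup p z)) (f z))"

text \<open>Every vector is uniquely a finite sum of components in the members of the family.\<close>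

definition is_direct_sum :: "'b set set \<Rightarrow> bool"
  where "is_direct_sum \<D> \<longleftrightarrow>
    (\<forall>D\<in>\<D>. subspace D) \<and>
    (\<forall>x. \<exists>!d. (\<forall>D\<in>\<D>. d D \<in> D) \<and> (\<forall>D. D \<notin> \<D> \<longrightarrow> d D = 0) \<and>
              finite {D. d D \<noteq> 0} \<and> x = (\<Sum>D | d D \<noteq> 0. d D))"

end


section \<open>Coalgebras and Hopf algebras\<close>

locale coalgebra = vector_space_tensor scale
  for scale :: "'k::field \<Rightarrow> 'c::ab_group_add \<Rightarrow> 'c" +
  fixes \<Delta> :: "'c \<Rightarrow> ('c \<times> 'c \<Rightarrow>\<^sub>0 int) set"
    and \<epsilon> :: "'c \<Rightarrow> 'k"
  assumes comult_in: "\<Delta> x \<in> tensor2"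
    and comult_add: "\<Delta> (x + y) = plus2 (\<Delta> x) (\<Delta> y)"
    and comult_scale: "\<Delta> (scale c x) = scale2 c (\<Delta> x)"
    and counit_add: "\<epsilon> (x + y) = \<epsilon> x + \<epsilon> y"
    and counit_scale: "\<epsilon> (scale c x) = c * \<epsilon> x"
    \<comment> \<open>\<open>D\<close> is any choice of representatives of \<open>\<Delta>\<close>, as in Sweedler notation\<close>
    and coassoc: "(\<And>y. D y \<in> \<Delta> y) \<Longrightarrow>
      (frag_extend (\<lambda>(a, b). frag_extend (\<lambda>(u, v). frag_of (u, v, b)) (D a)) (D x),
       frag_extend (\<lambda>(a, b). frag_extend (\<lambda>(u, v). frag_of (a, u, v)) (D b)) (D x)) \<in> rel3"
    and counit_left: "p \<in> \<Delta> x \<Longrightarrow> eval_frag (\<lambda>(a, b). scale (\<epsilon> a) b) p = x"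
    and counit_right: "p \<in> \<Delta> x \<Longrightarrow> eval_frag (\<lambda>(a, b). scale (\<epsilon> b) a) p = x"
begin

text \<open>
  Over a field the map \<open>D \<otimes> D \<rightarrow> C \<otimes> C\<close> is injective; \<open>D \<otimes> D\<close> is identified with its
  image, the classes having a representative supported on \<open>D \<times> D\<close>.
\<close>

definition subcoalgebra :: "'c set \<Rightarrow> bool"
  where "subcoalgebra D \<longleftrightarrow> subspace D \<and>
    (\<forall>x\<in>D. \<Delta> x \<in> {rel2 `` {p} | p. Poly_Mapping.keys p \<subseteq> D \<times> D})"

definition simple_subcoalgebra :: "'c set \<Rightarrow> bool"
  where "simple_subcoalgebra D \<longleftrightarrow> subcoalgebra D \<and> D \<noteq> {0} \<and>
    (\<forall>E. subcoalgebra E \<and> E \<subseteq> D \<longrightarrow> E = {0} \<or> E = D)"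

definition cosemisimple :: bool
  where "cosemisimple \<longleftrightarrow> is_direct_sum {D. simple_subcoalgebra D}"

end

text \<open>
  The multiplication and unit of the Hopf algebra are those of the type class; its requirement
  \<open>0 \<noteq> 1\<close> is automatic, as the counit sends \<open>1\<close> to \<open>1\<close>.
\<close>

locale hopf_algebra = coalgebra scale \<Delta> \<epsilon>
  for scale :: "'k::field \<Rightarrow> 'h::ring_1 \<Rightarrow> 'h"
    and \<Delta> :: "'h \<Rightarrow> ('h \<times> 'h \<Rightarrow>\<^sub>0 int) set"
    and \<epsilon> :: "'h \<Rightarrow> 'k" +
  fixes S :: "'h \<Rightarrow> 'h"
  assumes scale_mult_left: "scale c x * y = scale c (x * y)"
    and scale_mult_right: "x * scale c y = scale c (x * y)"
    and comult_one: "\<Delta> 1 = rel2 `` {frag_of (1, 1)}"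
    and comult_mult: "\<Delta> (x * y) = (\<Union>p\<in>\<Delta> x. \<Union>q\<in>\<Delta> y.
      rel2 `` {frag_extend (\<lambda>(a, b). frag_extend (\<lambda>(c, d). frag_of (a * c, b * d)) q) p})"
    and counit_one: "\<epsilon> 1 = 1"
    and counit_mult: "\<epsilon> (x * y) = \<epsilon> x * \<epsilon> y"
    and antipode_add: "S (x + y) = S x + S y"
    and antipode_scale: "S (scale c x) = scale c (S x)"
    and antipode_left: "p \<in> \<Delta> x \<Longrightarrow> eval_frag (\<lambda>(a, b). S a * b) p = scale (\<epsilon> x) 1"
    and antipode_right: "p \<in> \<Delta> x \<Longrightarrow> eval_frag (\<lambda>(a, b). a * S b) p = scale (\<epsilon> x) 1"
begin

definition hopf_subalgebra :: "'h set \<Rightarrow> bool"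
  where "hopf_subalgebra A \<longleftrightarrow> subcoalgebra A \<and>
    1 \<in> A \<and> (\<forall>x\<in>A. \<forall>y\<in>A. x * y \<in> A) \<and> (\<forall>x\<in>A. S x \<in> A)"

end

end

theory Submission
  imports Defs
begin

text \<open>
  Let \<open>E : H \<rightarrow> A\<close> be the projection that kills the simple subcoalgebras not contained in \<open>A\<close>.
  It is a bicomodule map, and the antipode makes it \<open>A\<close>-bilinear: for \<open>a \<in> A\<close> the tensor
  \<open>b\<^sub>1 \<otimes> E (a b\<^sub>2) = S a\<^sub>1 a\<^sub>2 b\<^sub>1 \<otimes> E (a\<^sub>3 b\<^sub>2) = S a\<^sub>1 E (a\<^sub>2 b\<^sub>1) \<otimes> a\<^sub>3 b\<^sub>2\<close> lies in \<open>A \<otimes> H\<close>,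
  and applying \<open>x \<mapsto> \<epsilon> (x - E x)\<close> to its first factor gives \<open>E (a b) = a E b\<close>.
  Let \<open>s\<close> be a linear endomorphism of \<open>H\<close> that vanishes on \<open>H A\<^sup>+\<close> and is the identity modulo
  \<open>H A\<^sup>+\<close>, where \<open>A\<^sup>+\<close> is the kernel of \<open>\<epsilon>\<close> on \<open>A\<close>.  Then
  \<open>h \<mapsto> s(h\<^sub>1)\<^sub>1 \<otimes> E (S (s(h\<^sub>1)\<^sub>2) h\<^sub>2)\<close> is a right \<open>A\<close>-linear section of the multiplication
  \<open>H \<otimes> A \<rightarrow> H\<close>, so \<open>H\<close> is a projective right \<open>A\<close>-module, and \<open>E\<close> exhibits \<open>A\<close> as a direct
  summand; hence \<open>H\<close> is faithfully flat.  The left version is the same statement for the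
  opposite of the co-opposite Hopf algebra.
\<close>

section \<open>Faithful flatness from a dual basis\<close>

text \<open>Works in a bare abelian group: at most one of the two intervals is nonempty, so a single
  formula serves both signs.\<close>

definition zmul :: "int \<Rightarrow> 'a::ab_group_add \<Rightarrow> 'a"
  where "zmul n x = (\<Sum>i\<in>{0..<n}. x) - (\<Sum>i\<in>{n..<0}. x)"

lemma zmul_0 [simp]: "zmul 0 x = 0"
  by (simp add: zmul_def)

lemma zmul_Suc: "zmul (n + 1) x = zmul n x + x"
proof (cases "0 \<le> n")
  case True
  then have "{0..<n + 1} = insert n {0..<n}" and "{n + 1..<0} = {}" and "{n..<0} = {}"
    by auto
  then show ?thesis
    by (simp add: zmul_def add.commute)
next
  case False
  then have "{n..<0} = insert n {n + 1..<0}" and "{0..<n + 1} = {}" and "{0..<n} = {}"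
    by auto
  then show ?thesis
    by (simp add: zmul_def)
qed

lemma zmul_1 [simp]: "zmul 1 x = x"
  using zmul_Suc[of 0 x] by simp

lemma zmul_add: "zmul (m + n) x = zmul m x + zmul n x"
proof -
  have nat: "zmul (m + int k) x = zmul m x + zmul (int k) x" for m k
  proof (induction k)
    case (Suc k)
    then show ?case
      using zmul_Suc[of "m + int k" x] zmul_Suc[of "int k" x] by (simp add: ac_simps)
  qed simp
  \<comment> \<open>A negative \<open>n\<close> is reached by adding \<open>- n\<close> back, both
    to \<open>m + n\<close> and to \<open>n\<close> itself.\<close>
  show ?thesis
    using nat[of "m + n" "nat (- n)"] nat[of n "nat (- n)"] nat[of m "nat n"]
    by (cases "0 \<le> n") (simp_all add: algebra_simps)
qed

text \<open>The homomorphism extending \<open>f\<close> to the free abelian group. Unlike for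
  \<open>eval_frag\<close>, the target may be any abelian group, in particular a test
  module.\<close>

definition frag_eval :: "('z \<Rightarrow> 'a::ab_group_add) \<Rightarrow> ('z \<Rightarrow>\<^sub>0 int) \<Rightarrow> 'a"
  where "frag_eval f p = (\<Sum>z\<in>Poly_Mapping.keys p. zmul (Poly_Mapping.lookup p z) (f z))"

lemma frag_eval_superset:
  "finite K \<Longrightarrow> Poly_Mapping.keys p \<subseteq> K \<Longrightarrow> frag_eval f p = (\<Sum>z\<in>K. zmul (Poly_Mapping.lookup p z) (f z))"
  unfolding frag_eval_def by (rule sum.mono_neutral_left) (auto simp: in_keys_iff)

lemma frag_eval_add: "frag_eval f (p + q) = frag_eval f p + frag_eval f q"
  using keys_add[of p q]
  by (simp add: frag_eval_superset[of "Poly_Mapping.keys p \<union> Poly_Mapping.keys q"] lookup_add zmul_add sum.distrib)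

lemma frag_eval_0 [simp]: "frag_eval f 0 = 0"
  by (simp add: frag_eval_def)

lemma frag_eval_of [simp]: "frag_eval f (frag_of z) = f z"
  by (simp add: frag_eval_def)

lemma frag_eval_diff: "frag_eval f (p - q) = frag_eval f p - frag_eval f q"
  using frag_eval_add[of f "p - q" q] by (simp add: algebra_simps)

lemma frag_eval_sum: "frag_eval f (\<Sum>i\<in>I. p i) = (\<Sum>i\<in>I. frag_eval f (p i))"
  by (induction I rule: infinite_finite_induct) (simp_all add: frag_eval_add)

lemma frag_eval_extend: "frag_eval f (frag_extend g p) = frag_eval (\<lambda>z. frag_eval f (g z)) p"
  using subset_UNIV by (induction p rule: frag_induction) (simp_all add: frag_extend_diff frag_eval_diff)

lemma frag_eval_hom:
  assumes "\<And>x y. L (x + y) = L x + L y"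
  shows "L (frag_eval f p) = frag_eval (\<lambda>z. L (f z)) p"
proof -
  have L0: "L 0 = 0"
    using assms[of 0 0] by simp
  have L_diff: "L (x - y) = L x - L y" for x y
    using assms[of "x - y" y] by simp
  show ?thesis
    using subset_UNIV by (induction p rule: frag_induction) (simp_all add: L0 L_diff frag_eval_diff)
qed

text \<open>The kernel of an evaluation is a subgroup. Well-definedness of maps out of a tensor
  product is reduced to the relators in this way.\<close>

lemma frag_eval_group_closure:
  assumes "p \<in> group_closure G" and "\<And>z. z \<in> G \<Longrightarrow> frag_eval f z = 0"
  shows "frag_eval f p = 0"
  using assms by (induction rule: group_closure.induct) (auto simp: frag_eval_diff)

lemma frag_extend_group_closure:
  assumes "p \<in> group_closure G" and "\<And>z. z \<in> G \<Longrightarrow> frag_extend f z \<in> group_closure G'"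
  shows "frag_extend f p \<in> group_closure G'"
  using assms by (induction rule: group_closure.induct) (auto simp: frag_extend_diff intro: group_closure.diff)

lemma group_closure_sum: "(\<And>i. i \<in> I \<Longrightarrow> p i \<in> group_closure G) \<Longrightarrow> sum p I \<in> group_closure G"
  by (induction I rule: infinite_finite_induct) (auto intro: group_closure_add)

section \<open>Tensor relations, and exactness tested on representatives\<close>

lemma equiv_tensor_rel: "equiv UNIV (tensor_rel R ract lact)"
proof (rule equivI)
  show "sym (tensor_rel R ract lact)"
    unfolding sym_def tensor_rel_def using group_closure_minus_iff
    by (metis (no_types, lifting) case_prodD case_prodI mem_Collect_eq minus_diff_eq)
  show "trans (tensor_rel R ract lact)"
    unfolding trans_def tensor_rel_def
    using group_closure_add by fastforce
qed (auto simp: refl_on_def tensor_rel_def)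

lemma tensor_relators_in_closure:
  fixes R :: "'r set" and ract :: "'m::ab_group_add \<Rightarrow> 'r \<Rightarrow> 'm" and lact :: "'r \<Rightarrow> 'n::ab_group_add \<Rightarrow> 'n"
  defines "G \<equiv> group_closure (tensor_relators R ract lact)"
  shows tensor_add_left: "frag_of (x + x', y) - frag_of (x, y) - frag_of (x', y) \<in> G"
    and tensor_add_right: "frag_of (x, y + y') - frag_of (x, y) - frag_of (x, y') \<in> G"
    and tensor_balance: "a \<in> R \<Longrightarrow> frag_of (ract x a, y) - frag_of (x, lact a y) \<in> G"
    and tensor_zero_left: "frag_of (0, y) \<in> G"
    and tensor_zero_right: "frag_of (x, 0) \<in> G"
    and tensor_diff_right: "frag_of (x, y - y') - (frag_of (x, y) - frag_of (x, y')) \<in> G"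
    and tensor_sum_left: "finite I \<Longrightarrow> frag_of (sum f I, y) - (\<Sum>i\<in>I. frag_of (f i, y)) \<in> G"
proof -
  show add_left: "frag_of (x + x', y) - frag_of (x, y) - frag_of (x', y) \<in> G" for x x' y
    unfolding G_def tensor_relators_def by (rule group_closure.base) blast
  show add_right: "frag_of (x, y + y') - frag_of (x, y) - frag_of (x, y') \<in> G" for x y y'
    unfolding G_def tensor_relators_def by (rule group_closure.base) blast
  show "a \<in> R \<Longrightarrow> frag_of (ract x a, y) - frag_of (x, lact a y) \<in> G"
    unfolding G_def tensor_relators_def by (rule group_closure.base) blast
  have neg: "- p \<in> G \<longleftrightarrow> p \<in> G" for p
    by (simp add: G_def)
  \<comment> \<open>The additivity relator at 0 + 0 is the negative of the wanted symbol.\<close>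
  show zero_left: "frag_of (0, y) \<in> G" for y
    using add_left[of 0 0 y] neg[of "frag_of (0, y)"] by simp
  show "frag_of (x, 0) \<in> G"
    using add_right[of x 0 0] neg[of "frag_of (x, 0)"] by simp
  show "frag_of (x, y - y') - (frag_of (x, y) - frag_of (x, y')) \<in> G"
    using add_right[of x "y - y'" y'] neg[of "frag_of (x, y - y') - (frag_of (x, y) - frag_of (x, y'))"]
    by (simp add: algebra_simps)
  show "frag_of (sum f I, y) - (\<Sum>i\<in>I. frag_of (f i, y)) \<in> G" if "finite I"
    using that
  proof (induction I rule: finite_induct)
    case (insert i I)
    then show ?case
      using group_closure_add[OF add_left[of "f i" "sum f I" y, unfolded G_def] insert.IH[unfolded G_def]]
      by (simp add: G_def algebra_simps)
  qed (simp add: zero_left)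
qed

text \<open>Every class has a representative and \<open>F\<close>, \<open>G\<close> respect the
  relations, so image and kernel can be compared inside the free groups. The module arguments below
  never handle classes.\<close>

lemma exact_quotient_iff:
  assumes equiv: "equiv UNIV rel1" "equiv UNIV rel2" "equiv UNIV rel3"
    and F: "\<And>p q. (p, q) \<in> rel1 \<Longrightarrow> (F p, F q) \<in> rel2"
    and G: "\<And>p q. (p, q) \<in> rel2 \<Longrightarrow> (G p, G q) \<in> rel3"
  shows "(\<lambda>t. \<Union>p\<in>t. rel2 `` {F p}) ` (UNIV // rel1) =
      {t \<in> UNIV // rel2. (\<Union>p\<in>t. rel3 `` {G p}) = rel3 `` {0}} \<longleftrightarrow>
    (\<forall>p. (\<exists>q. (F q, p) \<in> rel2) \<longleftrightarrow> (G p, 0) \<in> rel3)"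
proof -
  have F_class: "(\<Union>p\<in>rel1 `` {q}. rel2 `` {F p}) = rel2 `` {F q}" for q
    by (rule UN_equiv_class[OF equiv(1)])
      (auto simp: congruent_def intro!: equiv_class_eq[OF equiv(2)] F)
  have G_class: "(\<Union>p\<in>rel2 `` {q}. rel3 `` {G p}) = rel3 `` {G q}" for q
    by (rule UN_equiv_class[OF equiv(2)])
      (auto simp: congruent_def intro!: equiv_class_eq[OF equiv(3)] G)
  have L: "(\<lambda>t. \<Union>p\<in>t. rel2 `` {F p}) ` (UNIV // rel1) = range (\<lambda>q. rel2 `` {F q})"
    unfolding quotient_def using F_class by (auto simp: image_iff)
  have R: "{t \<in> UNIV // rel2. (\<Union>p\<in>t. rel3 `` {G p}) = rel3 `` {0}} =
      (\<lambda>p. rel2 `` {p}) ` {p. (G p, 0) \<in> rel3}"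
  proof (intro set_eqI iffI)
    fix t
    assume "t \<in> {t \<in> UNIV // rel2. (\<Union>p\<in>t. rel3 `` {G p}) = rel3 `` {0}}"
    then obtain p where "t = rel2 `` {p}" and "rel3 `` {G p} = rel3 `` {0}"
      using G_class by (auto elim!: quotientE)
    then show "t \<in> (\<lambda>p. rel2 `` {p}) ` {p. (G p, 0) \<in> rel3}"
      using eq_equiv_class_iff[OF equiv(3)] by blast
  next
    fix t
    assume "t \<in> (\<lambda>p. rel2 `` {p}) ` {p. (G p, 0) \<in> rel3}"
    then obtain p where t: "t = rel2 `` {p}" and "(G p, 0) \<in> rel3"
      by blast
    then have "rel3 `` {G p} = rel3 `` {0}"
      using equiv_class_eq[OF equiv(3)] by blast
    then show "t \<in> {t \<in> UNIV // rel2. (\<Union>p\<in>t. rel3 `` {G p}) = rel3 `` {0}}"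
      unfolding t using G_class[of p] by (simp add: quotientI)
  qed
  have in_L: "rel2 `` {p} \<in> range (\<lambda>q. rel2 `` {F q}) \<longleftrightarrow> (\<exists>q. (F q, p) \<in> rel2)" for p
    using eq_equiv_class_iff[OF equiv(2)] equiv(2) by (auto simp: image_iff elim!: equivE dest: symD)
  have in_R: "rel2 `` {p} \<in> (\<lambda>p. rel2 `` {p}) ` {p. (G p, 0) \<in> rel3} \<longleftrightarrow> (G p, 0) \<in> rel3" for p
  proof
    assume "rel2 `` {p} \<in> (\<lambda>p. rel2 `` {p}) ` {p. (G p, 0) \<in> rel3}"
    then obtain p' where "(p, p') \<in> rel2" "(G p', 0) \<in> rel3"
      using eq_equiv_class_iff[OF equiv(2)] by (auto simp: image_iff)
    then show "(G p, 0) \<in> rel3"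
      using G equiv(3) by (meson equivE transD)
  qed blast
  \<comment> \<open>Image and kernel both consist of classes, so they are compared one class at a
    time.\<close>
  have "X = Y \<longleftrightarrow> (\<forall>p. rel2 `` {p} \<in> X \<longleftrightarrow> rel2 `` {p} \<in> Y)"
    if "X \<subseteq> range (\<lambda>p. rel2 `` {p})" "Y \<subseteq> range (\<lambda>p. rel2 `` {p})" for X Y
    using that by blast
  from this[of "range (\<lambda>q. rel2 `` {F q})" "(\<lambda>p. rel2 `` {p}) ` {p. (G p, 0) \<in> rel3}"] show ?thesis
    unfolding L R in_L in_R by blast
qed

section \<open>Modules with a dual basis\<close>

text \<open>The product is a parameter so that right modules are covered as left modules for the
  reversed multiplication.\<close>

definition module_action :: "'r::ab_group_add set \<Rightarrow> ('r \<Rightarrow> 'r \<Rightarrow> 'r) \<Rightarrow> 'r \<Rightarrow> ('r \<Rightarrow> 'm::ab_group_add \<Rightarrow> 'm) \<Rightarrow> bool"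
  where "module_action R mul one act \<longleftrightarrow>
    (\<forall>r\<in>R. \<forall>x y. act r (x + y) = act r x + act r y) \<and>
    (\<forall>r\<in>R. \<forall>s\<in>R. \<forall>x. act (r + s) x = act r x + act s x) \<and>
    (\<forall>r\<in>R. \<forall>s\<in>R. \<forall>x. act (mul r s) x = act r (act s x)) \<and>
    (\<forall>x. act one x = x)"

text \<open>Projectivity as in the dual basis lemma, each vector \<open>i\<close> being its own
  index: \<open>\<phi> i\<close> is the coordinate functional belonging to the generator
  \<open>i\<close>. The functional \<open>E\<close> with value \<open>one\<close> at
  \<open>e\<close> splits the map sending \<open>a\<close> to \<open>pact e a\<close>, which
  exhibits the ring as a direct summand.\<close>

locale dual_basis_module =
  fixes R :: "'r::ab_group_add set"
    and mul :: "'r \<Rightarrow> 'r \<Rightarrow> 'r"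
    and one :: 'r
    and pact :: "'p::ab_group_add \<Rightarrow> 'r \<Rightarrow> 'p"
    and \<phi> :: "'p \<Rightarrow> 'p \<Rightarrow> 'r"
    and E :: "'p \<Rightarrow> 'r"
    and e :: 'p
  assumes \<phi>_in: "\<phi> i x \<in> R"
    and \<phi>_add: "\<phi> i (x + y) = \<phi> i x + \<phi> i y"
    and \<phi>_act: "a \<in> R \<Longrightarrow> \<phi> i (pact x a) = mul (\<phi> i x) a"
    and \<phi>_finite: "finite {i. \<phi> i x \<noteq> 0}"
    and \<phi>_sum: "(\<Sum>i | \<phi> i x \<noteq> 0. pact i (\<phi> i x)) = x"
    and pact_zero: "pact x 0 = 0"
    and E_in: "E x \<in> R"
    and E_add: "E (x + y) = E x + E y"
    and E_act: "a \<in> R \<Longrightarrow> E (pact x a) = mul (E x) a"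
    and E_e: "E e = one"
begin

abbreviation closure :: "('r \<Rightarrow> 'm::ab_group_add \<Rightarrow> 'm) \<Rightarrow> ('p \<times> 'm \<Rightarrow>\<^sub>0 int) set"
  where "closure act \<equiv> group_closure (tensor_relators R pact act)"

text \<open>On classes this is \<psi> \<otimes> id followed by the identification of R \<otimes> M
  with M.\<close>

definition contract :: "('r \<Rightarrow> 'm::ab_group_add \<Rightarrow> 'm) \<Rightarrow> ('p \<Rightarrow> 'r) \<Rightarrow> ('p \<times> 'm \<Rightarrow>\<^sub>0 int) \<Rightarrow> 'm"
  where "contract act \<psi> = frag_eval (\<lambda>(x, y). act (\<psi> x) y)"

definition functional :: "('p \<Rightarrow> 'r) \<Rightarrow> bool"
  where "functional \<psi> \<longleftrightarrow> (\<forall>x. \<psi> x \<in> R) \<and> (\<forall>x y. \<psi> (x + y) = \<psi> x + \<psi> y) \<and>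
    (\<forall>x. \<forall>a\<in>R. \<psi> (pact x a) = mul (\<psi> x) a)"

lemma functional_\<phi>: "functional (\<phi> i)"
  by (simp add: functional_def \<phi>_in \<phi>_add \<phi>_act)

lemma functional_E: "functional E"
  by (simp add: functional_def E_in E_add E_act)

lemma contract_closure:
  assumes "module_action R mul one act" and "functional \<psi>" and "p \<in> closure act"
  shows "contract act \<psi> p = 0"
  unfolding contract_def using assms(3)
proof (rule frag_eval_group_closure)
  fix z
  assume "z \<in> tensor_relators R pact act"
  with assms(1,2) show "frag_eval (\<lambda>(x, y). act (\<psi> x) y) z = 0"
    unfolding tensor_relators_def module_action_def functional_def by (auto simp: frag_eval_diff)
qed

lemma contract_cong:
  assumes "module_action R mul one act" and "functional \<psi>" and "p - q \<in> closure act"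
  shows "contract act \<psi> p = contract act \<psi> q"
  using contract_closure[OF assms] by (simp add: contract_def frag_eval_diff)

lemma contract_map:
  assumes "functional \<psi>" and "left_module_hom R act act' g"
  shows "contract act' \<psi> (frag_extend (\<lambda>(x, y). frag_of (id x, g y)) p) = g (contract act \<psi> p)"
proof -
  have "g (contract act \<psi> p) = frag_eval (\<lambda>z. g (case z of (x, y) \<Rightarrow> act (\<psi> x) y)) p"
    unfolding contract_def by (rule frag_eval_hom) (use assms(2) in \<open>simp add: left_module_hom_def\<close>)
  then show ?thesis
    using assms by (simp add: contract_def frag_eval_extend functional_def left_module_hom_def case_prod_unfold)
qed

text \<open>Expanding x in the dual basis and moving the scalars across gives x \<otimes> y = sum of
  i \<otimes> \<phi>_i(x) y. Hence a tensor is determined by its contractions.\<close>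

lemma dual_basis_expansion:
  assumes act: "module_action R mul one act"
  obtains I where "finite I"
    and "p - (\<Sum>i\<in>I. frag_of (i, contract act (\<phi> i) p)) \<in> closure act"
proof -
  \<comment> \<open>The claim is made for every finite set above \<open>I0\<close>, so that the
    index sets of \<open>a\<close> and \<open>b\<close> can both be enlarged to their union.\<close>
  have "\<exists>I0. finite I0 \<and> (\<forall>I. finite I \<and> I0 \<subseteq> I \<longrightarrow>
      p - (\<Sum>i\<in>I. frag_of (i, contract act (\<phi> i) p)) \<in> closure act)"
    using subset_UNIV
  proof (induction p rule: frag_induction)
    case zero
    have "- (\<Sum>i\<in>I. frag_of (i, 0)) \<in> closure act" for I
      unfolding group_closure_minus_iff by (intro group_closure_sum tensor_zero_right)
    then show ?case
      by (auto simp: contract_def)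
  next
    case (one z)
    obtain x y where z: "z = (x, y)" by fastforce
    have "frag_of z - (\<Sum>i\<in>I. frag_of (i, contract act (\<phi> i) (frag_of z))) \<in> closure act"
      if "finite I" "{i. \<phi> i x \<noteq> 0} \<subseteq> I" for I
    proof -
      have "(\<Sum>i\<in>I. pact i (\<phi> i x)) = (\<Sum>i | \<phi> i x \<noteq> 0. pact i (\<phi> i x))"
        using that by (intro sum.mono_neutral_right) (auto simp: pact_zero)
      then have x: "(\<Sum>i\<in>I. pact i (\<phi> i x)) = x"
        by (simp add: \<phi>_sum)
      have "frag_of (\<Sum>i\<in>I. pact i (\<phi> i x), y) - (\<Sum>i\<in>I. frag_of (pact i (\<phi> i x), y)) \<in> closure act"
        by (rule tensor_sum_left) fact
      moreover have "(\<Sum>i\<in>I. frag_of (pact i (\<phi> i x), y) - frag_of (i, act (\<phi> i x) y)) \<in> closure act"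
        by (intro group_closure_sum tensor_balance \<phi>_in)
      ultimately have "(frag_of (\<Sum>i\<in>I. pact i (\<phi> i x), y) - (\<Sum>i\<in>I. frag_of (pact i (\<phi> i x), y))) +
          (\<Sum>i\<in>I. frag_of (pact i (\<phi> i x), y) - frag_of (i, act (\<phi> i x) y)) \<in> closure act"
        by (rule group_closure_add)
      then show ?thesis
        by (simp add: z x contract_def sum_subtractf)
    qed
    then show ?case
      by (intro exI[of _ "{i. \<phi> i x \<noteq> 0}"]) (simp add: \<phi>_finite)
  next
    case (diff a b)
    let ?P = "\<lambda>J p. \<forall>I. finite I \<and> J \<subseteq> I \<longrightarrow>
      p - (\<Sum>i\<in>I. frag_of (i, contract act (\<phi> i) p)) \<in> closure act"
    obtain Ia where "finite Ia" and a: "?P Ia a"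
      using diff.IH(1) by (elim exE conjE)
    obtain Ib where "finite Ib" and b: "?P Ib b"
      using diff.IH(2) by (elim exE conjE)
    have "a - b - (\<Sum>i\<in>I. frag_of (i, contract act (\<phi> i) (a - b))) \<in> closure act"
      if "finite I" "Ia \<union> Ib \<subseteq> I" for I
    proof -
      let ?c = "\<lambda>i. contract act (\<phi> i)"
      \<comment> \<open>Contraction is additive, but the symbol of a difference equals the
        difference of symbols only modulo the relators.\<close>
      have "(\<Sum>i\<in>I. frag_of (i, ?c i a - ?c i b) - (frag_of (i, ?c i a) - frag_of (i, ?c i b))) \<in> closure act"
        by (intro group_closure_sum tensor_diff_right)
      then have Z: "(\<Sum>i\<in>I. frag_of (i, ?c i a - ?c i b))
          - ((\<Sum>i\<in>I. frag_of (i, ?c i a)) - (\<Sum>i\<in>I. frag_of (i, ?c i b))) \<in> closure act"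
        by (simp add: sum_subtractf)
      have "a - (\<Sum>i\<in>I. frag_of (i, ?c i a)) \<in> closure act" "b - (\<Sum>i\<in>I. frag_of (i, ?c i b)) \<in> closure act"
        using a b that by simp_all
      from group_closure.diff[OF group_closure.diff[OF this] Z]
      have "(a - (\<Sum>i\<in>I. frag_of (i, ?c i a))) - (b - (\<Sum>i\<in>I. frag_of (i, ?c i b)))
          - ((\<Sum>i\<in>I. frag_of (i, ?c i a - ?c i b))
          - ((\<Sum>i\<in>I. frag_of (i, ?c i a)) - (\<Sum>i\<in>I. frag_of (i, ?c i b)))) \<in> closure act" .
      then have "a - b - (\<Sum>i\<in>I. frag_of (i, ?c i a - ?c i b)) \<in> closure act"
        by (simp add: algebra_simps)
      then show ?thesis
        by (simp add: contract_def frag_eval_diff)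
    qed
    then show ?case
      using \<open>finite Ia\<close> \<open>finite Ib\<close> by (intro exI[of _ "Ia \<union> Ib"]) simp
  qed
  then show thesis
    using that by blast
qed

lemma tensor_map_closure:
  assumes "left_module_hom R act act' g" and "p \<in> closure act"
  shows "frag_extend (\<lambda>(x, y). frag_of (id x, g y)) p \<in> closure act'"
  using assms(2)
proof (rule frag_extend_group_closure)
  fix z
  assume "z \<in> tensor_relators R pact act"
  then show "frag_extend (\<lambda>(x, y). frag_of (id x, g y)) z \<in> closure act'"
    using assms(1) tensor_relators_in_closure[where R = R and ract = pact and lact = act']
    unfolding tensor_relators_def left_module_hom_def by (auto simp: frag_extend_diff)
qed

text \<open>Forward: contractions commute with module maps, so a tensor killed by id \<otimes> g has
  its contractions in the kernel of g; these lift through f, and the lifts reassemble. Backward: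
  contraction with \<open>E\<close> recovers x from e \<otimes> x.\<close>

lemma exact_iff:
  fixes act1 :: "'r \<Rightarrow> 'm1::ab_group_add \<Rightarrow> 'm1" and act2 :: "'r \<Rightarrow> 'm2::ab_group_add \<Rightarrow> 'm2"
    and act3 :: "'r \<Rightarrow> 'm3::ab_group_add \<Rightarrow> 'm3"
  assumes act: "module_action R mul one act1" "module_action R mul one act2" "module_action R mul one act3"
    and f: "left_module_hom R act1 act2 f" and g: "left_module_hom R act2 act3 g"
  shows "range f = {x. g x = 0} \<longleftrightarrow>
    (\<forall>p. (\<exists>q. (frag_extend (\<lambda>(x, y). frag_of (id x, f y)) q, p) \<in> tensor_rel R pact act2) \<longleftrightarrow>
      (frag_extend (\<lambda>(x, y). frag_of (id x, g y)) p, 0) \<in> tensor_rel R pact act3)"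
    (is "_ \<longleftrightarrow> (\<forall>p. (\<exists>q. (?F q, p) \<in> _) \<longleftrightarrow> (?G p, 0) \<in> _)")
proof -
  have rel: "(p, q) \<in> tensor_rel R pact act \<longleftrightarrow> p - q \<in> closure act"
    for p q and act :: "'r \<Rightarrow> 'm::ab_group_add \<Rightarrow> 'm"
    by (simp add: tensor_rel_def)
  have diff_comm: "q - p \<in> closure act \<longleftrightarrow> p - q \<in> closure act"
    for p q and act :: "'r \<Rightarrow> 'm::ab_group_add \<Rightarrow> 'm"
    using group_closure_minus_iff[of "p - q"] by simp
  have G_diff: "?G (p - q) = ?G p - ?G q" for p q
    by (simp add: frag_extend_diff)
  show ?thesis
    unfolding rel
  proof
    assume ex: "range f = {x. g x = 0}"
    show "\<forall>p. (\<exists>q. ?F q - p \<in> closure act2) \<longleftrightarrow> ?G p - 0 \<in> closure act3"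
    proof (intro allI iffI)
      fix p
      assume "\<exists>q. ?F q - p \<in> closure act2"
      then obtain q where "?F q - p \<in> closure act2" ..
      from tensor_map_closure[OF g this] have GFp: "?G (?F q) - ?G p \<in> closure act3"
        unfolding G_diff .
      \<comment> \<open>Since g o f = 0, every symbol is sent to one of the form (x, 0).\<close>
      have GF: "?G (?F q) \<in> closure act3"
        using subset_UNIV
      proof (induction q rule: frag_induction)
        case (one z)
        have "g (f y) = 0" for y
          using ex by blast
        then show ?case
          by (auto simp: case_prod_unfold intro!: tensor_zero_right)
      qed (auto simp: frag_extend_diff intro: group_closure.diff)
      from group_closure.diff[OF GF GFp] show "?G p - 0 \<in> closure act3"
        by simp
    next
      fix p
      assume Gp: "?G p - 0 \<in> closure act3"
      obtain I where I: "finite I" and p: "p - (\<Sum>i\<in>I. frag_of (i, contract act2 (\<phi> i) p)) \<in> closure act2"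
        using dual_basis_expansion[OF act(2)] by blast
      have "g (contract act2 (\<phi> i) p) = 0" for i
        using contract_cong[OF act(3) functional_\<phi> Gp] contract_map[OF functional_\<phi> g]
        by (simp add: contract_def)
      then have "\<forall>i. \<exists>m. contract act2 (\<phi> i) p = f m"
        using ex by blast
      then obtain m where "\<And>i. contract act2 (\<phi> i) p = f (m i)"
        by metis
      \<comment> \<open>The preimages \<open>m i\<close> of the contractions, put back into the
        expansion, give a preimage of \<open>p\<close>.\<close>
      then have "?F (\<Sum>i\<in>I. frag_of (i, m i)) = (\<Sum>i\<in>I. frag_of (i, contract act2 (\<phi> i) p))"
        using I by (simp add: frag_extend_sum)
      with p have "p - ?F (\<Sum>i\<in>I. frag_of (i, m i)) \<in> closure act2"
        by simp
      then show "\<exists>q. ?F q - p \<in> closure act2"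
        by (subst (asm) diff_comm) (rule exI)
    qed
  next
    assume ex: "\<forall>p. (\<exists>q. ?F q - p \<in> closure act2) \<longleftrightarrow> ?G p - 0 \<in> closure act3"
    have one: "act2 one x = x" "act3 one y = y" for x y
      using act by (simp_all add: module_action_def)
    show "range f = {x. g x = 0}"
    proof (intro set_eqI iffI)
      fix x
      assume "x \<in> range f"
      then obtain y where x: "x = f y" ..
      have "?F (frag_of (e, y)) - frag_of (e, x) \<in> closure act2"
        by (simp add: x)
      then have "?G (frag_of (e, x)) - 0 \<in> closure act3"
        using ex by blast
      from contract_cong[OF act(3) functional_E this] show "x \<in> {x. g x = 0}"
        by (simp add: contract_def E_e one)
    next
      fix x
      assume "x \<in> {x. g x = 0}"
      then have "?G (frag_of (e, x)) - 0 \<in> closure act3"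
        by (simp add: tensor_zero_right)
      then obtain q where "?F q - frag_of (e, x) \<in> closure act2"
        using ex by blast
      \<comment> \<open>As \<open>E e\<close> is \<open>one\<close>, contracting e \<otimes> x gives
        \<open>x\<close>, and naturality displays it as the image under \<open>f\<close> of the
        contraction of \<open>q\<close>.\<close>
      from contract_cong[OF act(2) functional_E this] have "x = f (contract act1 E q)"
        unfolding contract_map[OF functional_E f] by (simp add: contract_def E_e one)
      then show "x \<in> range f"
        by (rule range_eqI)
    qed
  qed
qed

end

lemma faithfully_flat_rightI:
  fixes ract :: "'p::ab_group_add \<Rightarrow> 'r::ring_1 \<Rightarrow> 'p"
  assumes "right_module R ract" and "dual_basis_module R (*) 1 ract \<phi> E e"
  shows "faithfully_flat_right TYPE('m1::ab_group_add) TYPE('m2::ab_group_add) TYPE('m3::ab_group_add) R ract"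
proof -
  interpret dual_basis_module R "(*)" 1 ract \<phi> E e
    by fact
  have act: "left_module R act \<longleftrightarrow> module_action R (*) 1 act" for act :: "'r \<Rightarrow> 'm::ab_group_add \<Rightarrow> 'm"
    by (simp add: left_module_def module_action_def)
  have resp: "(frag_extend (\<lambda>(x, y). frag_of (id x, f y)) p, frag_extend (\<lambda>(x, y). frag_of (id x, f y)) q)
      \<in> tensor_rel R ract act'"
    if "left_module_hom R act act' f" "(p, q) \<in> tensor_rel R ract act"
    for act :: "'r \<Rightarrow> 'm::ab_group_add \<Rightarrow> 'm" and act' :: "'r \<Rightarrow> 'n::ab_group_add \<Rightarrow> 'n" and f p q
    using tensor_map_closure[OF that(1), of "p - q"] that(2) by (simp add: tensor_rel_def frag_extend_diff)
  show ?thesis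
    unfolding faithfully_flat_right_def
  proof (intro conjI allI impI)
    fix act1 :: "'r \<Rightarrow> 'm1 \<Rightarrow> 'm1" and act2 :: "'r \<Rightarrow> 'm2 \<Rightarrow> 'm2" and act3 :: "'r \<Rightarrow> 'm3 \<Rightarrow> 'm3" and f g
    assume "left_module R act1 \<and> left_module R act2 \<and> left_module R act3 \<and>
      left_module_hom R act1 act2 f \<and> left_module_hom R act2 act3 g"
    then have acts: "module_action R (*) 1 act1" "module_action R (*) 1 act2" "module_action R (*) 1 act3"
      and f: "left_module_hom R act1 act2 f" and g: "left_module_hom R act2 act3 g"
      by (simp_all add: act)
    show "range f = {x. g x = 0} \<longleftrightarrow>
       tensor_map (tensor_rel R ract act2) id f ` tensor R ract act1 =
       {t \<in> tensor R ract act2.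
          tensor_map (tensor_rel R ract act3) id g t = tensor_rel R ract act3 `` {0}}"
      unfolding exact_iff[OF acts f g] tensor_def tensor_map_def
      by (rule exact_quotient_iff[symmetric, OF equiv_tensor_rel equiv_tensor_rel equiv_tensor_rel
            resp[OF f] resp[OF g]])
  qed fact
qed

section \<open>Exchange of the tensor factors and the left version\<close>

definition frag_swap :: "('m \<times> 'n \<Rightarrow>\<^sub>0 int) \<Rightarrow> 'n \<times> 'm \<Rightarrow>\<^sub>0 int"
  where "frag_swap = frag_extend (\<lambda>(x, y). frag_of (y, x))"

lemma frag_swap_swap [simp]: "frag_swap (frag_swap p) = p"
  using subset_UNIV by (induction p rule: frag_induction) (auto simp: frag_swap_def frag_extend_diff)

lemma frag_swap_map:
  "frag_swap (frag_extend (\<lambda>(x, y). frag_of (f x, g y)) p) =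
    frag_extend (\<lambda>(x, y). frag_of (g x, f y)) (frag_swap p)"
  using subset_UNIV by (induction p rule: frag_induction) (auto simp: frag_swap_def frag_extend_diff)

lemma tensor_rel_swap_imp:
  assumes "(p, q) \<in> tensor_rel R ract lact"
  shows "(frag_swap p, frag_swap q) \<in> tensor_rel R (\<lambda>x r. lact r x) (\<lambda>r y. ract y r)"
proof -
  have "frag_swap (p - q) \<in> group_closure (tensor_relators R (\<lambda>x r. lact r x) (\<lambda>r y. ract y r))"
    using assms unfolding frag_swap_def tensor_rel_def
  proof (elim CollectE case_prodE, simp, elim frag_extend_group_closure)
    fix z
    assume "z \<in> tensor_relators R ract lact"
    \<comment> \<open>A swapped balancing relator is the negative of a balancing relator for the
      exchanged actions.\<close>
    then show "frag_extend (\<lambda>(x, y). frag_of (y, x)) z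
        \<in> group_closure (tensor_relators R (\<lambda>x r. lact r x) (\<lambda>r y. ract y r))"
      using group_closure_minus_iff[of "frag_of (x, ract y a) - frag_of (lact a x, y)"
          "tensor_relators R (\<lambda>x r. lact r x) (\<lambda>r y. ract y r)" for x y a]
        tensor_balance[where ract = "\<lambda>x r. lact r x" and lact = "\<lambda>r y. ract y r" and R = R]
      unfolding tensor_relators_def[of R ract]
      by (auto simp: frag_extend_diff intro: tensor_add_left tensor_add_right)
  qed
  then show ?thesis
    by (simp add: tensor_rel_def frag_swap_def frag_extend_diff)
qed

lemma tensor_rel_swap:
  "(frag_swap p, frag_swap q) \<in> tensor_rel R (\<lambda>x r. lact r x) (\<lambda>r y. ract y r) \<longleftrightarrow>
    (p, q) \<in> tensor_rel R ract lact"
  using tensor_rel_swap_imp[of p q R ract lact]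
    tensor_rel_swap_imp[of "frag_swap p" "frag_swap q" R "\<lambda>x r. lact r x" "\<lambda>r y. ract y r"] by auto

text \<open>A left module is a right module for the reversed product, and swapping the factors
  identifies the tensor products, so \<open>exact_iff\<close> applies.\<close>

lemma faithfully_flat_leftI:
  fixes lact :: "'r::ring_1 \<Rightarrow> 'p::ab_group_add \<Rightarrow> 'p"
  assumes "left_module R lact" and "dual_basis_module R (\<lambda>r s. s * r) 1 (\<lambda>x r. lact r x) \<phi> E e"
  shows "faithfully_flat_left TYPE('m1::ab_group_add) TYPE('m2::ab_group_add) TYPE('m3::ab_group_add) R lact"
proof -
  interpret dual_basis_module R "\<lambda>r s. s * r" 1 "\<lambda>x r. lact r x" \<phi> E e
    by fact
  have act: "right_module R act \<longleftrightarrow> module_action R (\<lambda>r s. s * r) 1 (\<lambda>r x. act x r)"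
    for act :: "'m::ab_group_add \<Rightarrow> 'r \<Rightarrow> 'm"
    by (auto simp: right_module_def module_action_def)
  have hom: "right_module_hom R act act' f \<longleftrightarrow> left_module_hom R (\<lambda>r x. act x r) (\<lambda>r x. act' x r) f"
    for act :: "'m::ab_group_add \<Rightarrow> 'r \<Rightarrow> 'm" and act' :: "'n::ab_group_add \<Rightarrow> 'r \<Rightarrow> 'n" and f
    by (simp add: right_module_hom_def left_module_hom_def)
  have resp: "(frag_extend (\<lambda>(x, y). frag_of (f x, id y)) p, frag_extend (\<lambda>(x, y). frag_of (f x, id y)) q)
      \<in> tensor_rel R act' lact"
    if f: "right_module_hom R act act' f" and pq: "(p, q) \<in> tensor_rel R act lact"
    for act :: "'m::ab_group_add \<Rightarrow> 'r \<Rightarrow> 'm" and act' :: "'n::ab_group_add \<Rightarrow> 'r \<Rightarrow> 'n" and f p q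
  proof -
    have "frag_swap p - frag_swap q \<in> closure (\<lambda>r x. act x r)"
      using tensor_rel_swap_imp[OF pq] by (simp add: tensor_rel_def)
    from tensor_map_closure[OF f[unfolded hom] this]
    show ?thesis
      by (subst tensor_rel_swap[symmetric])
        (simp add: frag_swap_map tensor_rel_def frag_extend_diff)
  qed
  \<comment> \<open>The swap is an involution, so quantifiers over tensors may be reindexed along
    it.\<close>
  have all_swap: "(\<forall>p. P p) \<longleftrightarrow> (\<forall>p. P (frag_swap p))" and ex_swap: "(\<exists>p. P p) \<longleftrightarrow> (\<exists>p. P (frag_swap p))"
    for P :: "('m \<times> 'n \<Rightarrow>\<^sub>0 int) \<Rightarrow> bool"
  proof -
    have "P p \<Longrightarrow> P (frag_swap (frag_swap p))" for p
      by simp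
    then show "(\<exists>p. P p) \<longleftrightarrow> (\<exists>p. P (frag_swap p))"
      by blast
    have "(\<forall>p. P (frag_swap p)) \<Longrightarrow> P (frag_swap (frag_swap p))" for p
      by (erule allE)
    then show "(\<forall>p. P p) \<longleftrightarrow> (\<forall>p. P (frag_swap p))"
      by auto
  qed
  show ?thesis
    unfolding faithfully_flat_left_def
  proof (intro conjI allI impI)
    fix act1 :: "'m1 \<Rightarrow> 'r \<Rightarrow> 'm1" and act2 :: "'m2 \<Rightarrow> 'r \<Rightarrow> 'm2" and act3 :: "'m3 \<Rightarrow> 'r \<Rightarrow> 'm3" and f g
    assume "right_module R act1 \<and> right_module R act2 \<and> right_module R act3 \<and>
      right_module_hom R act1 act2 f \<and> right_module_hom R act2 act3 g"
    then have acts: "module_action R (\<lambda>r s. s * r) 1 (\<lambda>r x. act1 x r)"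
        "module_action R (\<lambda>r s. s * r) 1 (\<lambda>r x. act2 x r)" "module_action R (\<lambda>r s. s * r) 1 (\<lambda>r x. act3 x r)"
      and f: "right_module_hom R act1 act2 f" and g: "right_module_hom R act2 act3 g"
      by (simp_all add: act)
    have swap_0: "frag_swap 0 = 0"
      by (simp add: frag_swap_def)
    have "range f = {x. g x = 0} \<longleftrightarrow>
      (\<forall>p. (\<exists>q. (frag_extend (\<lambda>(x, y). frag_of (f x, id y)) q, p) \<in> tensor_rel R act2 lact) \<longleftrightarrow>
        (frag_extend (\<lambda>(x, y). frag_of (g x, id y)) p, 0) \<in> tensor_rel R act3 lact)"
      unfolding exact_iff[OF acts f[unfolded hom] g[unfolded hom]]
      by (subst all_swap, subst ex_swap)
        (simp only: tensor_rel_swap[symmetric, where lact = lact] frag_swap_map swap_0)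
    also have "\<dots> \<longleftrightarrow> tensor_map (tensor_rel R act2 lact) f id ` tensor R act1 lact =
       {t \<in> tensor R act2 lact.
          tensor_map (tensor_rel R act3 lact) g id t = tensor_rel R act3 lact `` {0}}"
      unfolding tensor_def tensor_map_def
      by (rule exact_quotient_iff[symmetric, OF equiv_tensor_rel equiv_tensor_rel equiv_tensor_rel
            resp[OF f] resp[OF g]])
    finally show "range f = {x. g x = 0} \<longleftrightarrow>
       tensor_map (tensor_rel R act2 lact) f id ` tensor R act1 lact =
       {t \<in> tensor R act2 lact.
          tensor_map (tensor_rel R act3 lact) g id t = tensor_rel R act3 lact `` {0}}" .
  qed fact
qed


section \<open>Hopf algebras with a bicolinear projection\<close>

context vector_space_tensor
begin

text \<open>Test maps take values in the space itself, so that one type serves in all assumptions of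
  the locale \<open>sweedler_hopf\<close>.\<close>

definition bilin :: "('b \<Rightarrow> 'b \<Rightarrow> 'b) \<Rightarrow> bool"
  where "bilin f \<longleftrightarrow>
    (\<forall>x y z. f (x + y) z = f x z + f y z) \<and>
    (\<forall>x y z. f x (y + z) = f x y + f x z) \<and>
    (\<forall>c x y. f (scale c x) y = scale c (f x y)) \<and>
    (\<forall>c x y. f x (scale c y) = scale c (f x y))"

definition trilin :: "('b \<Rightarrow> 'b \<Rightarrow> 'b \<Rightarrow> 'b) \<Rightarrow> bool"
  where "trilin f \<longleftrightarrow> (\<forall>z. bilin (\<lambda>x y. f x y z)) \<and> (\<forall>x. bilin (f x))"

end

definition sweedler_sum ::
  "('h \<Rightarrow> nat) \<Rightarrow> ('h \<Rightarrow> nat \<Rightarrow> 'h) \<Rightarrow> ('h \<Rightarrow> nat \<Rightarrow> 'h) \<Rightarrow> ('h \<Rightarrow> 'h \<Rightarrow> 'w::ab_group_add) \<Rightarrow> 'h \<Rightarrow> 'w"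
  where "sweedler_sum N l r f x = (\<Sum>i<N x. f (l x i) (r x i))"

text \<open>
  Here \<open>\<Delta> x\<close> is represented by the sum of \<open>l x i \<otimes> r x i\<close> over \<open>i < N x\<close>, and identities between
  tensors are stated by testing them against multilinear maps.  The multiplication is a
  parameter, so that the opposite of the co-opposite is again an instance.
\<close>

locale sweedler_hopf = vector_space_tensor scale
  for scale :: "'k::field \<Rightarrow> 'h::ab_group_add \<Rightarrow> 'h" +
  fixes N :: "'h \<Rightarrow> nat"
    and l r :: "'h \<Rightarrow> nat \<Rightarrow> 'h"
    and mul :: "'h \<Rightarrow> 'h \<Rightarrow> 'h" (infixl "\<odot>" 70)
    and one :: 'h
    and \<epsilon> :: "'h \<Rightarrow> 'k"
    and S :: "'h \<Rightarrow> 'h"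
    and A :: "'h set"
    and E :: "'h \<Rightarrow> 'h"
  assumes mul_bilin: "bilin (\<odot>)"
    and mul_assoc: "(x \<odot> y) \<odot> z = x \<odot> (y \<odot> z)"
    and one_mul: "one \<odot> x = x"
    and mul_one: "x \<odot> one = x"
    and eps_add: "\<epsilon> (x + y) = \<epsilon> x + \<epsilon> y"
    and eps_scale: "\<epsilon> (scale c x) = c * \<epsilon> x"
    and eps_mul: "\<epsilon> (x \<odot> y) = \<epsilon> x * \<epsilon> y"
    and S_add: "S (x + y) = S x + S y"
    and S_scale: "S (scale c x) = scale c (S x)"
    and sw_add: "bilin f \<Longrightarrow>
      sweedler_sum N l r f (x + y) = sweedler_sum N l r f x + sweedler_sum N l r f y"
    and sw_scale: "bilin f \<Longrightarrow> sweedler_sum N l r f (scale c x) = scale c (sweedler_sum N l r f x)"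
    and sw_coassoc: "trilin F \<Longrightarrow>
      sweedler_sum N l r (\<lambda>a b. sweedler_sum N l r (\<lambda>u v. F u v b) a) x =
      sweedler_sum N l r (\<lambda>a b. sweedler_sum N l r (\<lambda>u v. F a u v) b) x"
    and sw_counit_left: "sweedler_sum N l r (\<lambda>u v. scale (\<epsilon> u) v) x = x"
    and sw_counit_right: "sweedler_sum N l r (\<lambda>u v. scale (\<epsilon> v) u) x = x"
    and sw_mul: "bilin f \<Longrightarrow> sweedler_sum N l r f (x \<odot> y) =
      sweedler_sum N l r (\<lambda>a b. sweedler_sum N l r (\<lambda>c d. f (a \<odot> c) (b \<odot> d)) y) x"
    and sw_antipode_left: "sweedler_sum N l r (\<lambda>u v. S u \<odot> v) x = scale (\<epsilon> x) one"
    and sw_antipode_right: "sweedler_sum N l r (\<lambda>u v. u \<odot> S v) x = scale (\<epsilon> x) one"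
    and one_in: "one \<in> A"
    and mul_in: "a \<in> A \<Longrightarrow> b \<in> A \<Longrightarrow> a \<odot> b \<in> A"
    and S_in: "a \<in> A \<Longrightarrow> S a \<in> A"
    and A_subspace: "subspace A"
    and l_in: "a \<in> A \<Longrightarrow> i < N a \<Longrightarrow> l a i \<in> A"
    and r_in: "a \<in> A \<Longrightarrow> i < N a \<Longrightarrow> r a i \<in> A"
    and E_add: "E (x + y) = E x + E y"
    and E_scale: "E (scale c x) = scale c (E x)"
    and E_in: "E x \<in> A"
    and E_id: "a \<in> A \<Longrightarrow> E a = a"
    and E_colinear_left: "bilin f \<Longrightarrow> sweedler_sum N l r (\<lambda>u v. f (E u) v) x = sweedler_sum N l r f (E x)"
    and E_colinear_right: "bilin f \<Longrightarrow> sweedler_sum N l r (\<lambda>u v. f u (E v)) x = sweedler_sum N l r f (E x)"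
begin

abbreviation sw :: "('h \<Rightarrow> 'h \<Rightarrow> 'h) \<Rightarrow> 'h \<Rightarrow> 'h"
  where "sw \<equiv> sweedler_sum N l r"

lemma mul_lin:
  "(x + y) \<odot> z = x \<odot> z + y \<odot> z" "x \<odot> (y + z) = x \<odot> y + x \<odot> z"
  "scale c x \<odot> y = scale c (x \<odot> y)" "x \<odot> scale c y = scale c (x \<odot> y)"
  using mul_bilin by (auto simp: bilin_def)

lemmas lin = mul_lin S_add S_scale E_add E_scale eps_add eps_scale
  scale_left_distrib scale_right_distrib mult.commute

lemma sw_hom:
  assumes "\<And>x y. L (x + y) = L x + L y"
  shows "L (sw f x) = sw (\<lambda>u v. L (f u v)) x"
proof -
  have "L 0 = 0"
    using assms[of 0 0] by simp
  then show ?thesis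
    unfolding sweedler_sum_def using assms by (induction "N x") (simp_all add: sum_comp_morphism[symmetric, of L] o_def)
qed

lemma sw_plus: "sw (\<lambda>u v. f u v + g u v) x = sw f x + sw g x"
  by (simp add: sweedler_sum_def sum.distrib)

lemma sw_minus: "sw (\<lambda>u v. f u v - g u v) x = sw f x - sw g x"
  by (simp add: sweedler_sum_def sum_subtractf)

lemma sw_zero [simp]: "sw (\<lambda>u v. 0) x = 0"
  by (simp add: sweedler_sum_def)

lemma sw_scale_fun: "sw (\<lambda>u v. scale c (f u v)) x = scale c (sw f x)"
  by (simp add: sweedler_sum_def scale_sum_right)

lemma sw_swap: "sw (\<lambda>a b. sw (\<lambda>c d. F a b c d) y) x = sw (\<lambda>c d. sw (\<lambda>a b. F a b c d) x) y"
  unfolding sweedler_sum_def by (rule sum.swap)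

text \<open>Both legs of the chosen representative of an element of \<open>A\<close> lie in
  \<open>A\<close>, so identities valid only over \<open>A\<close> may be used under the
  sum.\<close>

lemma sw_cong_in:
  assumes "x \<in> A" and "\<And>u v. u \<in> A \<Longrightarrow> v \<in> A \<Longrightarrow> f u v = g u v"
  shows "sw f x = sw g x"
  unfolding sweedler_sum_def using assms l_in r_in by (intro sum.cong) auto

lemma sw_mul_left: "a \<odot> sw f x = sw (\<lambda>u v. a \<odot> f u v) x"
  by (rule sw_hom) (simp add: lin)

lemma sw_mul_right: "sw f x \<odot> a = sw (\<lambda>u v. f u v \<odot> a) x"
  by (rule sw_hom[where L = "\<lambda>z. z \<odot> a"]) (simp add: lin)

lemma E_sw: "E (sw f x) = sw (\<lambda>u v. E (f u v)) x"
  by (rule sw_hom) (simp add: lin)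

lemma bilinI:
  assumes "\<And>x y z. f (x + y) z = f x z + f y z" and "\<And>x y z. f x (y + z) = f x y + f x z"
    and "\<And>c x y. f (scale c x) y = scale c (f x y)" and "\<And>c x y. f x (scale c y) = scale c (f x y)"
  shows "bilin f"
  using assms by (simp add: bilin_def)

lemma bilinD:
  assumes "bilin f"
  shows "f (x + y) z = f x z + f y z" "f x (y + z) = f x y + f x z"
    "f (scale c x) y = scale c (f x y)" "f x (scale c y) = scale c (f x y)"
  using assms by (simp_all add: bilin_def)

lemma bilin_sw_const:
  assumes "\<And>u v. bilin (\<lambda>p q. F p q u v)"
  shows "bilin (\<lambda>p q. sw (F p q) x)"
  by (rule bilinI)
    (simp_all add: sweedler_sum_def bilinD[OF assms] sum.distrib scale_sum_right)

text \<open>The representative chosen for a sum is not the sum of the representatives; linearity in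
  the comultiplied variable comes from \<open>sw_add\<close> and \<open>sw_scale\<close>.\<close>

lemma bilin_sw_left:
  assumes "trilin F"
  shows "bilin (\<lambda>a b. sw (\<lambda>u v. F u v b) a)"
proof -
  have 1: "bilin (\<lambda>u v. F u v b)" and 2: "bilin (F b)" for b
    using assms by (simp_all add: trilin_def)
  show ?thesis
    by (rule bilinI) (simp_all add: sw_add[OF 1] sw_scale[OF 1] bilinD[OF 2] sw_plus sw_scale_fun)
qed

text \<open>Reversing product and coproduct together interchanges the two antipode laws and so keeps
  \<open>S\<close>; reversing only one of them would call for the inverse of
  \<open>S\<close>.\<close>

lemma mirror: "sweedler_hopf scale N r l (\<lambda>x y. y \<odot> x) one \<epsilon> S A E"
proof -
  have flip: "sweedler_sum N r l f = sw (\<lambda>u v. f v u)" for f :: "'h \<Rightarrow> 'h \<Rightarrow> 'h"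
    by (simp add: sweedler_sum_def fun_eq_iff)
  have bil: "bilin f \<Longrightarrow> bilin (\<lambda>u v. f v u)" for f
    by (auto simp: bilin_def)
  have tril: "trilin F \<Longrightarrow> trilin (\<lambda>u v w. F w v u)" for F
    by (auto simp: trilin_def bilin_def)
  show ?thesis
  proof unfold_locales
    show "sweedler_sum N r l (\<lambda>u v. f (E u) v) x = sweedler_sum N r l f (E x)" if "bilin f" for f x
      unfolding flip using E_colinear_right[OF bil[OF that]] .
    show "sweedler_sum N r l (\<lambda>u v. f u (E v)) x = sweedler_sum N r l f (E x)" if "bilin f" for f x
      unfolding flip using E_colinear_left[OF bil[OF that]] .
  qed (use sw_coassoc[OF tril] sw_mul[OF bil] sw_swap in \<open>simp_all add: flip bil mul_bilin mul_assoc
        one_mul mul_one eps_add eps_scale eps_mul S_add S_scale sw_add sw_scale sw_counit_left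
        sw_counit_right sw_antipode_left sw_antipode_right one_in mul_in S_in A_subspace l_in r_in
        E_add E_scale E_in E_id\<close>)
qed

section \<open>Linearity of the projection and antimultiplicativity of the antipode\<close>

lemma E_left_linear:
  assumes a: "a \<in> A"
  shows "E (a \<odot> b) = a \<odot> E b"
proof -
  \<comment> \<open>Applies the functional u -> \<epsilon>(u - E u), which vanishes on
    \<open>A\<close>, to the first factor of a tensor.\<close>
  define g where "g u v = scale (\<epsilon> (u - E u)) v" for u v
  have eps_diff: "\<epsilon> (x - y) = \<epsilon> x - \<epsilon> y" for x y
    using eps_add[of "x - y" y] by simp
  have g: "bilin g"
    by (rule bilinI) (simp_all add: g_def eps_diff lin algebra_simps)
  have g_A: "g u v = 0" if "u \<in> A" for u v
    using that eps_diff[of 0 0] by (simp add: g_def E_id)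
  \<comment> \<open>The test \<open>g\<close> applied to p b_1 \<otimes> E (q b_2).\<close>
  define G where "G p q = sw (\<lambda>u v. g (p \<odot> u) (E (q \<odot> v))) b" for p q
  have G: "bilin G"
    unfolding G_def
    by (rule bilin_sw_const, rule bilinI) (simp_all add: lin bilinD[OF g])
  \<comment> \<open>The legs combine to the coproduct of q b. Colinearity moves \<open>E\<close>
    from the second leg to the first, which becomes \<open>S p \<odot> E u\<close>, an element of
    \<open>A\<close>, and \<open>g\<close> kills it.\<close>
  have G_S: "sw (\<lambda>u v. G (S p \<odot> u) v) q = 0" if "p \<in> A" for p q
  proof -
    have f: "bilin (\<lambda>u v. g (S p \<odot> u) v)" "bilin (\<lambda>u v. g (S p \<odot> u) (E v))"
      by (rule bilinI; simp add: lin bilinD[OF g])+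
    have "sw (\<lambda>u v. G (S p \<odot> u) v) q = sw (\<lambda>u v. g (S p \<odot> u) (E v)) (q \<odot> b)"
      by (simp add: sw_mul[OF f(2)] G_def mul_assoc)
    also have "\<dots> = sw (\<lambda>u v. g (S p \<odot> E u) v) (q \<odot> b)"
      using E_colinear_left[OF f(1)] E_colinear_right[OF f(1)] by simp
    also have "\<dots> = 0"
      by (simp add: g_A mul_in S_in that E_in)
    finally show ?thesis .
  qed
  have tri: "trilin (\<lambda>u v w. G (S u \<odot> v) w)"
    unfolding trilin_def by (auto intro!: bilinI simp: lin bilinD[OF G])
  \<comment> \<open>Counit and antipode replace one \<otimes> a by S a_1 a_2 \<otimes> a_3. After
    regrouping, a_1 lies in \<open>A\<close> and \<open>G_S\<close> applies.\<close>
  have "G one a = G one (sw (\<lambda>u v. scale (\<epsilon> u) v) a)"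
    by (simp add: sw_counit_left)
  also have "\<dots> = sw (\<lambda>p q. G (scale (\<epsilon> p) one) q) a"
    by (subst sw_hom[where L = "G one"]) (simp_all add: bilinD[OF G] sweedler_sum_def)
  also have "\<dots> = sw (\<lambda>p q. sw (\<lambda>u v. G (S u \<odot> v) q) p) a"
    by (simp add: sw_antipode_left[symmetric] sw_hom[where L = "\<lambda>p. G p _"] bilinD[OF G])
  also have "\<dots> = sw (\<lambda>p q. sw (\<lambda>u v. G (S p \<odot> u) v) q) a"
    by (rule sw_coassoc[OF tri])
  also have "\<dots> = sw (\<lambda>p q. 0) a"
    by (rule sw_cong_in[OF a]) (rule G_S)
  finally have "sw (\<lambda>u v. g u (E (a \<odot> v))) b = 0"
    by (simp add: G_def one_mul)
  \<comment> \<open>The term with \<epsilon>(u) collapses by the counit; in the one with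
    \<epsilon>(E u), colinearity first turns \<open>b\<close> into \<open>E b\<close>.\<close>
  moreover have "sw (\<lambda>u v. g u (E (a \<odot> v))) b = E (a \<odot> b) - E (a \<odot> E b)"
  proof -
    have f: "bilin (\<lambda>u v. scale (\<epsilon> u) (E (a \<odot> v)))"
      by (rule bilinI) (simp_all add: lin)
    have "sw (\<lambda>u v. scale (\<epsilon> u) (E (a \<odot> v))) x = E (a \<odot> x)" for x
    proof -
      have "E (a \<odot> sw (\<lambda>u v. scale (\<epsilon> u) v) x) = sw (\<lambda>u v. scale (\<epsilon> u) (E (a \<odot> v))) x"
        by (subst sw_hom[where L = "\<lambda>z. E (a \<odot> z)"]) (simp_all add: lin)
      then show ?thesis
        by (simp add: sw_counit_left)
    qed
    then show ?thesis
      using E_colinear_left[OF f]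
      by (simp add: g_def eps_diff scale_left_diff_distrib sw_minus)
  qed
  ultimately show ?thesis
    using E_id[OF mul_in[OF a E_in]] by simp
qed

lemma E_right_linear: "a \<in> A \<Longrightarrow> E (b \<odot> a) = E b \<odot> a"
  by (rule sweedler_hopf.E_left_linear[OF mirror])

text \<open>The convolution argument: S(xy) and S(y) S(x) are both inverse to the multiplication.
  The product S(x_1 y_1) x_2 y_2 S(y_3) S(x_3) is contracted from the left and from the
  right.\<close>

lemma S_mul: "S (x \<odot> y) = S y \<odot> S x"
proof -
  have tri_y: "trilin (\<lambda>a b c. S (p \<odot> a) \<odot> (q \<odot> b) \<odot> S c)" for p q
    unfolding trilin_def by (auto intro!: bilinI simp: lin)
  have tri_x: "trilin (\<lambda>a b c. S (a \<odot> y) \<odot> b \<odot> S c)"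
    unfolding trilin_def by (auto intro!: bilinI simp: lin)
  have bi: "bilin (\<lambda>u v. S u \<odot> v)"
    by (rule bilinI) (simp_all add: lin)
  \<comment> \<open>\<open>sw Q x\<close> is that product. With \<open>a\<close>, \<open>b\<close>
    for the legs of \<open>x\<close>, the inner sum already groups the factors for the left
    contraction.\<close>
  define Q where "Q a b = sw (\<lambda>c d. sw (\<lambda>u v. S u \<odot> v) (a \<odot> c) \<odot> S d \<odot> S b) y" for a b
  have "Q a b = scale (\<epsilon> a) (S y \<odot> S b)" for a b
  proof -
    have "Q a b = sw (\<lambda>c d. scale (\<epsilon> a) (S (scale (\<epsilon> c) d) \<odot> S b)) y"
      by (simp add: Q_def sw_antipode_left eps_mul lin one_mul)
    also have "\<dots> = scale (\<epsilon> a) (S (sw (\<lambda>c d. scale (\<epsilon> c) d) y) \<odot> S b)"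
      by (subst sw_hom[where L = "\<lambda>z. scale (\<epsilon> a) (S z \<odot> S b)"]) (simp_all add: lin)
    finally show ?thesis
      by (simp add: sw_counit_left)
  qed
  then have "Q = (\<lambda>a b. scale (\<epsilon> a) (S y \<odot> S b))"
    by (simp add: fun_eq_iff)
  then have "sw Q x = S y \<odot> S (sw (\<lambda>a b. scale (\<epsilon> a) b) x)"
    by (subst sw_hom[where L = "\<lambda>z. S y \<odot> S z"]) (simp_all add: lin)
  then have "sw Q x = S y \<odot> S x"
    by (simp add: sw_counit_left)
  \<comment> \<open>For the right contraction, coassociativity in \<open>y\<close> brings y_2 next
    to S(y_3); the legs of \<open>x\<close> follow afterwards through \<open>tri_x\<close>.\<close>
  moreover have "Q a b = sw (\<lambda>u v. S (u \<odot> y) \<odot> v \<odot> S b) a" for a b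
  proof -
    have "Q a b = sw (\<lambda>c d. sw (\<lambda>u v. sw (\<lambda>p q. S (u \<odot> p) \<odot> (v \<odot> q) \<odot> S d \<odot> S b) c) a) y"
      by (simp add: Q_def sw_mul[OF bi] sw_mul_right)
    also have "\<dots> = sw (\<lambda>u v. sw (\<lambda>c d. sw (\<lambda>p q. S (u \<odot> p) \<odot> (v \<odot> q) \<odot> S d) c) y \<odot> S b) a"
      by (subst sw_swap) (simp add: sw_mul_right)
    also have "\<dots> = sw (\<lambda>u v. sw (\<lambda>c d. sw (\<lambda>p q. S (u \<odot> c) \<odot> (v \<odot> p) \<odot> S q) d) y \<odot> S b) a"
      by (simp only: sw_coassoc[OF tri_y])
    also have "\<dots> = sw (\<lambda>u v. S (u \<odot> sw (\<lambda>c d. scale (\<epsilon> d) c) y) \<odot> v \<odot> S b) a"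
    proof -
      have "sw (\<lambda>c d. sw (\<lambda>p q. S (u \<odot> c) \<odot> (v \<odot> p) \<odot> S q) d) y
          = sw (\<lambda>c d. S (u \<odot> scale (\<epsilon> d) c) \<odot> v) y" for u v
        by (simp add: mul_assoc sw_mul_left[symmetric] sw_antipode_right lin mul_one)
      also have "\<dots> u v = S (u \<odot> sw (\<lambda>c d. scale (\<epsilon> d) c) y) \<odot> v" for u v
        by (subst sw_hom[where L = "\<lambda>z. S (u \<odot> z) \<odot> v"]) (simp_all add: lin)
      finally show ?thesis by simp
    qed
    finally show ?thesis
      by (simp add: sw_counit_right)
  qed
  then have "sw Q x = sw (\<lambda>a b. sw (\<lambda>u v. S (u \<odot> y) \<odot> v \<odot> S b) a) x"
    by (simp add: sweedler_sum_def)
  then have "sw Q x = sw (\<lambda>a b. sw (\<lambda>u v. S (a \<odot> y) \<odot> u \<odot> S v) b) x"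
    by (simp only: sw_coassoc[OF tri_x])
  then have "sw Q x = sw (\<lambda>a b. S (scale (\<epsilon> b) a \<odot> y)) x"
    by (simp add: mul_assoc sw_mul_left[symmetric] sw_antipode_right lin mul_one)
  then have "sw Q x = S (sw (\<lambda>a b. scale (\<epsilon> b) a) x \<odot> y)"
    by (subst sw_hom[where L = "\<lambda>z. S (z \<odot> y)"]) (simp_all add: lin)
  then have "sw Q x = S (x \<odot> y)"
    by (simp add: sw_counit_right)
  ultimately show ?thesis by simp
qed


section \<open>The dual basis of H over A\<close>

text \<open>The span is H A^+, as y a - \<epsilon>(a) y = y (a - \<epsilon>(a) 1). A subspace has a
  linear projection \<open>q\<close> onto it, and s = 1 - q.\<close>

lemma augmentation_section:
  obtains s where "\<And>x y. s (x + y) = s x + s y" and "\<And>c x. s (scale c x) = scale c (s x)"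
    and "\<And>x a. a \<in> A \<Longrightarrow> s (x \<odot> a) = scale (\<epsilon> a) (s x)"
    and "\<And>x. x - s x \<in> span {y \<odot> a - scale (\<epsilon> a) y | y a. a \<in> A}"
proof -
  let ?J = "span {y \<odot> a - scale (\<epsilon> a) y | y a. a \<in> A}"
  interpret pair: vector_space_pair scale scale
    by unfold_locales
  have "Vector_Spaces.linear scale scale id"
    by (rule linear_id)
  then obtain q where q: "range q \<subseteq> ?J" "Vector_Spaces.linear scale scale q" "\<And>v. v \<in> ?J \<Longrightarrow> q v = v"
    using pair.linear_exists_left_inverse_on[of id ?J] by auto
  interpret q: Vector_Spaces.linear scale scale q by fact
  show thesis
  proof (rule that[of "\<lambda>x. x - q x"])
    show "x \<odot> a - q (x \<odot> a) = scale (\<epsilon> a) (x - q x)" if "a \<in> A" for x a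
    proof -
      have "x \<odot> a - scale (\<epsilon> a) x \<in> ?J"
        using that by (intro span_base) auto
      from q(3)[OF this] show ?thesis
        by (simp add: q.diff q.scale scale_right_diff_distrib algebra_simps)
    qed
    show "x - (x - q x) \<in> ?J" for x
      using q(1) by auto
  qed (simp_all add: q.add q.scale scale_right_diff_distrib)
qed

text \<open>
  The dual basis consists of the coordinates, in a linear basis of \<open>H\<close>, of the section of
  \<open>H \<otimes> A \<rightarrow> H\<close>.  The maps \<open>\<phi> i\<close> vanish for \<open>i\<close> outside that basis.
\<close>

theorem dual_basis_module:
  obtains \<phi> where "dual_basis_module A (\<odot>) one (\<odot>) \<phi> E one"
proof -
  obtain s where s_add: "\<And>x y. s (x + y) = s x + s y"
    and s_scale: "\<And>c x. s (scale c x) = scale c (s x)"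
    and s_mul: "\<And>x a. a \<in> A \<Longrightarrow> s (x \<odot> a) = scale (\<epsilon> a) (s x)"
    and s_span: "\<And>x. x - s x \<in> span {y \<odot> a - scale (\<epsilon> a) y | y a. a \<in> A}"
    using augmentation_section by blast
  \<comment> \<open>Coordinates in a linear basis of H, obtained by extending the empty set.\<close>
  define \<beta> where "\<beta> = representation (extend_basis {})"
  have basis: "independent (extend_basis {})" "span (extend_basis {}) = UNIV"
    using independent_empty independent_extend_basis span_extend_basis by blast+
  have \<beta>_add: "\<beta> (x + y) i = \<beta> x i + \<beta> y i" and \<beta>_scale: "\<beta> (scale c x) i = c * \<beta> x i" for c x y i
    using basis by (simp_all add: \<beta>_def representation_add representation_scale)
  have \<beta>_sum: "(\<Sum>i\<in>I. scale (\<beta> x i) i) = x" if "finite I" "{i. \<beta> x i \<noteq> 0} \<subseteq> I" for x I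
  proof -
    have "(\<Sum>i\<in>I. scale (\<beta> x i) i) = (\<Sum>i | \<beta> x i \<noteq> 0. scale (\<beta> x i) i)"
      using that by (intro sum.mono_neutral_right) auto
    then show ?thesis
      using sum_nonzero_representation_eq basis by (simp add: \<beta>_def)
  qed
  \<comment> \<open>For the tensor x_1 \<otimes> E (S x_2 y), \<open>K i\<close> is the coordinate
    at \<open>i\<close> in the first factor and \<open>\<Psi>\<close> is the product of the factors.
    Setting x = s(h_1), y = h_2 gives the section at h, with coordinates
    \<open>\<phi> i h\<close>.\<close>
  define K where "K i x y = sw (\<lambda>u v. scale (\<beta> u i) (E (S v \<odot> y))) x" for i x y
  define \<Psi> where "\<Psi> x y = sw (\<lambda>u v. u \<odot> E (S v \<odot> y)) x" for x y
  define \<phi> where "\<phi> i h = sw (\<lambda>x y. K i (s x) y) h" for i h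
  have K_in: "K i x y \<in> A" for i x y
    unfolding K_def sweedler_sum_def
    by (intro subspace_sum A_subspace subspace_scale E_in)
  have K: "bilin (K i)" for i
  proof -
    have "bilin (\<lambda>x y. sw (\<lambda>u v. scale (\<beta> u i) (E (S v \<odot> y))) x)"
      by (rule bilin_sw_left) (auto simp: trilin_def \<beta>_add \<beta>_scale lin intro!: bilinI)
    then show ?thesis
      by (simp add: K_def[abs_def])
  qed
  have \<Psi>: "bilin \<Psi>"
  proof -
    have "bilin (\<lambda>x y. sw (\<lambda>u v. u \<odot> E (S v \<odot> y)) x)"
      by (rule bilin_sw_left) (auto simp: trilin_def lin intro!: bilinI)
    then show ?thesis
      by (simp add: \<Psi>_def[abs_def])
  qed
  have Ks: "bilin (\<lambda>x y. K i (s x) y)" for i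
    by (rule bilinI) (simp_all add: bilinD[OF K] s_add s_scale)
  have K_mul: "K i x (y \<odot> a) = K i x y \<odot> a" if "a \<in> A" for i x y a
    by (simp add: K_def sw_mul_right mul_assoc[symmetric] E_right_linear[OF that] lin)
  \<comment> \<open>By \<open>s_mul\<close> the first leg of \<open>a\<close> becomes
    \<epsilon>(a_1), so all of \<open>a\<close> collects in the last argument, where
    \<open>E\<close> is right linear.\<close>
  have \<phi>_mul: "\<phi> i (h \<odot> a) = \<phi> i h \<odot> a" if a: "a \<in> A" for i h a
  proof -
    have "\<phi> i (h \<odot> a) = sw (\<lambda>x y. sw (\<lambda>c d. K i (s (x \<odot> c)) (y \<odot> d)) a) h"
      by (simp add: \<phi>_def sw_mul[OF Ks])
    also have "\<dots> = sw (\<lambda>x y. sw (\<lambda>c d. K i (s x) (y \<odot> scale (\<epsilon> c) d)) a) h"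
    proof -
      have "sw (\<lambda>c d. K i (s (x \<odot> c)) (y \<odot> d)) a = sw (\<lambda>c d. K i (s x) (y \<odot> scale (\<epsilon> c) d)) a" for x y
        by (rule sw_cong_in[OF a]) (simp add: s_mul bilinD[OF K] lin)
      then show ?thesis by simp
    qed
    also have "\<dots> = sw (\<lambda>x y. K i (s x) (y \<odot> sw (\<lambda>c d. scale (\<epsilon> c) d) a)) h"
    proof -
      have "K i p (y \<odot> sw (\<lambda>c d. scale (\<epsilon> c) d) a) = sw (\<lambda>c d. K i p (y \<odot> scale (\<epsilon> c) d)) a" for p y
        by (rule sw_hom[where L = "\<lambda>z. K i p (y \<odot> z)"]) (simp add: bilinD[OF K] lin)
      then show ?thesis by simp
    qed
    also have "\<dots> = \<phi> i h \<odot> a"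
      by (simp add: sw_counit_left K_mul[OF a] \<phi>_def sw_mul_right)
    finally show ?thesis .
  qed
  \<comment> \<open>S(x_2 a_2) = S(a_2) S(x_2), and left linearity of \<open>E\<close> pulls S(a_2)
    out, where it meets a_1.\<close>
  have \<Psi>_mul: "\<Psi> (x \<odot> a) y = scale (\<epsilon> a) (\<Psi> x y)" if a: "a \<in> A" for x a y
  proof -
    have f: "bilin (\<lambda>u v. u \<odot> E (S v \<odot> y))"
      by (rule bilinI) (simp_all add: lin)
    have "\<Psi> (x \<odot> a) y = sw (\<lambda>u v. sw (\<lambda>c d. u \<odot> c \<odot> E (S d \<odot> (S v \<odot> y))) a) x"
      by (simp add: \<Psi>_def sw_mul[OF f] S_mul mul_assoc)
    also have "\<dots> = sw (\<lambda>u v. sw (\<lambda>c d. u \<odot> (c \<odot> S d) \<odot> E (S v \<odot> y)) a) x"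
    proof -
      have "sw (\<lambda>c d. u \<odot> c \<odot> E (S d \<odot> (S v \<odot> y))) a = sw (\<lambda>c d. u \<odot> (c \<odot> S d) \<odot> E (S v \<odot> y)) a" for u v
        by (rule sw_cong_in[OF a]) (simp add: E_left_linear S_in mul_assoc)
      then show ?thesis by simp
    qed
    also have "\<dots> = scale (\<epsilon> a) (\<Psi> x y)"
      by (simp add: sw_mul_right[symmetric] sw_mul_left[symmetric] sw_antipode_right lin mul_one
          \<Psi>_def sw_scale_fun)
    finally show ?thesis .
  qed
  \<comment> \<open>By \<open>\<Psi>_mul\<close> the first argument matters only modulo H A^+, and
    \<open>s x\<close> is congruent to \<open>x\<close>.\<close>
  have \<Psi>_s: "\<Psi> (s x) y = \<Psi> x y" for x y
  proof -
    have "\<Psi> z y = 0" if "z \<in> span {y \<odot> a - scale (\<epsilon> a) y | y a. a \<in> A}" for z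
      using that
    proof (induction rule: span_induct)
      case base
      have "\<Psi> 0 y = 0"
        using bilinD(3)[OF \<Psi>, of 0 0 y] by simp
      then show ?case
        by (auto simp: subspace_def bilinD[OF \<Psi>])
    next
      case (step z)
      then obtain w a where z: "z = w \<odot> a - scale (\<epsilon> a) w" and a: "a \<in> A"
        by blast
      have "\<Psi> z y + scale (\<epsilon> a) (\<Psi> w y) = \<Psi> (z + scale (\<epsilon> a) w) y"
        by (simp add: bilinD[OF \<Psi>])
      also have "\<dots> = scale (\<epsilon> a) (\<Psi> w y)"
        by (simp add: z \<Psi>_mul[OF a])
      finally show ?case
        by simp
    qed
    from this[OF s_span[of x]] have "\<Psi> (s x) y = \<Psi> (x - s x) y + \<Psi> (s x) y"
      by simp
    also have "\<dots> = \<Psi> x y"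
      by (simp add: bilinD[OF \<Psi>, symmetric])
    finally show ?thesis .
  qed
  \<comment> \<open>Coassociativity gives h_1 E (S h_2 h_3), which the antipode law and E one = one
    reduce to h.\<close>
  have \<Psi>_sum: "sw \<Psi> h = h" for h
  proof -
    have tri: "trilin (\<lambda>u v w. u \<odot> E (S v \<odot> w))"
      unfolding trilin_def by (auto intro!: bilinI simp: lin)
    have "sw \<Psi> h = sw (\<lambda>x y. sw (\<lambda>u v. u \<odot> E (S v \<odot> y)) x) h"
      by (simp add: \<Psi>_def[abs_def])
    also have "\<dots> = sw (\<lambda>x y. sw (\<lambda>u v. x \<odot> E (S u \<odot> v)) y) h"
      by (rule sw_coassoc[OF tri])
    also have "\<dots> = sw (\<lambda>x y. scale (\<epsilon> y) x) h"
      by (simp add: sw_mul_left[symmetric] E_sw[symmetric] sw_antipode_left lin E_id one_in mul_one)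
    finally show ?thesis
      by (simp add: sw_counit_right)
  qed
  \<comment> \<open>Collects all basis vectors occurring in the first legs of the finitely many
    terms of the section at \<open>h\<close>.\<close>
  define I where "I h = (\<Union>j<N h. \<Union>k<N (s (l h j)). {i. \<beta> (l (s (l h j)) k) i \<noteq> 0})" for h
  have I: "finite (I h)" for h
    by (simp add: I_def \<beta>_def finite_representation)
  have \<phi>_I: "\<phi> i h = 0" if "i \<notin> I h" for i h
    using that by (auto simp: \<phi>_def K_def I_def sweedler_sum_def intro!: sum.neutral)
  have \<phi>_sum: "(\<Sum>i\<in>I h. i \<odot> \<phi> i h) = h" for h
  proof -
    have "(\<Sum>i\<in>I h. i \<odot> \<phi> i h) =
        (\<Sum>j<N h. \<Sum>k<N (s (l h j)). \<Sum>i\<in>I h. scale (\<beta> (l (s (l h j)) k) i) i \<odot>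
          E (S (r (s (l h j)) k) \<odot> r h j))"
      unfolding \<phi>_def K_def sw_mul_left unfolding sweedler_sum_def
      by (subst sum.swap, intro sum.cong refl, subst sum.swap) (simp add: lin)
    also have "\<dots> = (\<Sum>j<N h. \<Sum>k<N (s (l h j)). l (s (l h j)) k \<odot> E (S (r (s (l h j)) k) \<odot> r h j))"
    proof (intro sum.cong refl)
      fix j k
      assume "j \<in> {..<N h}" "k \<in> {..<N (s (l h j))}"
      then have "{i. \<beta> (l (s (l h j)) k) i \<noteq> 0} \<subseteq> I h"
        unfolding I_def by blast
      from \<beta>_sum[OF I this] show "(\<Sum>i\<in>I h. scale (\<beta> (l (s (l h j)) k) i) i \<odot> E (S (r (s (l h j)) k) \<odot> r h j))
          = l (s (l h j)) k \<odot> E (S (r (s (l h j)) k) \<odot> r h j)"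
        using sum_comp_morphism[of "\<lambda>z. z \<odot> E (S (r (s (l h j)) k) \<odot> r h j)" "\<lambda>i. scale (\<beta> (l (s (l h j)) k) i) i" "I h"]
          mul_lin(3)[of 0 0]
        by (simp add: o_def mul_lin)
    qed
    also have "\<dots> = sw (\<lambda>x y. \<Psi> (s x) y) h"
      by (simp add: \<Psi>_def sweedler_sum_def)
    also have "\<dots> = sw \<Psi> h"
      by (simp add: \<Psi>_s)
    finally show ?thesis
      by (simp add: \<Psi>_sum)
  qed
  have "dual_basis_module A (\<odot>) one (\<odot>) \<phi> E one"
  proof
    show "\<phi> i x \<in> A" for i x
      unfolding \<phi>_def sweedler_sum_def by (intro subspace_sum A_subspace K_in)
    show "\<phi> i (x + y) = \<phi> i x + \<phi> i y" for i x y
      by (simp add: \<phi>_def sw_add[OF Ks])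
    have sub: "{i. \<phi> i x \<noteq> 0} \<subseteq> I x" for x
      using \<phi>_I by blast
    then show "finite {i. \<phi> i x \<noteq> 0}" for x
      using I finite_subset by blast
    show mul_zero: "x \<odot> 0 = 0" for x
      using mul_lin(4)[of x 0 0] by simp
    have "(\<Sum>i | \<phi> i x \<noteq> 0. i \<odot> \<phi> i x) = (\<Sum>i\<in>I x. i \<odot> \<phi> i x)" for x
      using I sub by (intro sum.mono_neutral_left) (auto simp: mul_zero)
    then show "(\<Sum>i | \<phi> i x \<noteq> 0. i \<odot> \<phi> i x) = x" for x
      by (simp add: \<phi>_sum)
  qed (simp_all add: \<phi>_mul E_in E_add E_right_linear E_id one_in)
  then show thesis
    by (rule that)
qed

end


section \<open>The projection onto a Hopf subalgebra of a cosemisimple Hopf algebra\<close>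

context vector_space_tensor
begin

lemma zmul_eq_scale: "zmul n x = scale (of_int n) x"
proof (induction n rule: int_induct[of _ 0])
  case (step1 i)
  then show ?case
    by (simp add: zmul_Suc scale_left_distrib)
next
  case (step2 i)
  then show ?case
    using zmul_Suc[of "i - 1" x] by (simp add: scale_left_diff_distrib eq_diff_eq)
qed simp

lemma eval_frag_eq: "eval_frag f p = frag_eval f p"
  by (simp add: eval_frag_def frag_eval_def zmul_eq_scale)

lemma frag_eval_in_subspace:
  assumes "subspace V" and "\<And>z. z \<in> Poly_Mapping.keys p \<Longrightarrow> f z \<in> V"
  shows "frag_eval f p \<in> V"
  unfolding frag_eval_def zmul_eq_scale using assms by (intro subspace_sum subspace_scale)

lemma equiv_rel2: "equiv UNIV rel2"
  by (rule equiv_tensor_rel)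

lemma frag_eval_rel2:
  assumes "bilin f" and "(p, q) \<in> rel2"
  shows "frag_eval (\<lambda>(x, y). f x y) p = frag_eval (\<lambda>(x, y). f x y) q"
proof -
  have "frag_eval (\<lambda>(x, y). f x y) (p - q) = 0"
    using assms unfolding tensor_rel_def
    by (elim CollectE case_prodE, simp, elim frag_eval_group_closure)
      (auto simp: tensor_relators_def bilin_def frag_eval_diff)
  then show ?thesis
    by (simp add: frag_eval_diff)
qed

lemma frag_eval_rel3:
  assumes "trilin f" and "(p, q) \<in> rel3"
  shows "frag_eval (\<lambda>(x, y, z). f x y z) p = frag_eval (\<lambda>(x, y, z). f x y z) q"
proof -
  have "frag_eval (\<lambda>(x, y, z). f x y z) (p - q) = 0"
    using assms unfolding rel3_def
    by (elim CollectE case_prodE, simp, elim frag_eval_group_closure)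
      (auto simp: relators3_def trilin_def bilin_def frag_eval_diff)
  then show ?thesis
    by (simp add: frag_eval_diff)
qed

lemma frag_extend_rel2:
  assumes P: "\<And>x y. P (x + y) = P x + P y" "\<And>c x. P (scale c x) = scale c (P x)"
    and "(p, q) \<in> rel2"
  shows "(frag_extend (\<lambda>(x, y). frag_of (P x, P y)) p, frag_extend (\<lambda>(x, y). frag_of (P x, P y)) q) \<in> rel2"
proof -
  have "frag_extend (\<lambda>(x, y). frag_of (P x, P y)) (p - q)
      \<in> group_closure (tensor_relators UNIV (\<lambda>x c. scale c x) scale)"
    using assms(3) unfolding tensor_rel_def
  proof (elim CollectE case_prodE, simp, elim frag_extend_group_closure)
    fix z
    assume z: "z \<in> tensor_relators UNIV (\<lambda>x c. scale c x) scale"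
    show "frag_extend (\<lambda>(x, y). frag_of (P x, P y)) z
        \<in> group_closure (tensor_relators UNIV (\<lambda>x c. scale c x) scale)"
      using z[unfolded tensor_relators_def] tensor_balance[where R = UNIV and ract = "\<lambda>x c. scale c x" and lact = scale]
      by (auto simp: frag_extend_diff P intro: tensor_add_left tensor_add_right)
  qed
  then show ?thesis
    by (simp add: tensor_rel_def frag_extend_diff)
qed

text \<open>Negative coefficients are absorbed by -(x \<otimes> y) = (-x) \<otimes> y, which stays
  over \<open>D\<close>; what remains is a plain list of pure tensors, as in Sweedler
  notation.\<close>

lemma rel2_sum_of_pairs:
  assumes D: "subspace D" and "Poly_Mapping.keys p \<subseteq> D \<times> D"
  obtains n :: nat and l r where "(p, \<Sum>i<n. frag_of (l i, r i)) \<in> rel2"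
    and "\<And>i. i < n \<Longrightarrow> l i \<in> D \<and> r i \<in> D"
proof -
  let ?G = "group_closure (tensor_relators UNIV (\<lambda>x c. scale c x) scale)"
  let ?s = "\<lambda>xs. sum_list (map frag_of xs)"
  have "\<exists>xs. set xs \<subseteq> D \<times> D \<and> p - ?s xs \<in> ?G"
    using assms(2)
  proof (induction p rule: frag_induction)
    case zero
    show ?case
      by (rule exI[of _ "[]"]) simp
  next
    case (one z)
    then show ?case
      by (intro exI[of _ "[z]"]) simp
  next
    case (diff a b)
    from diff.IH obtain xs ys where xs: "set xs \<subseteq> D \<times> D" "a - ?s xs \<in> ?G"
      and ys: "set ys \<subseteq> D \<times> D" "b - ?s ys \<in> ?G"
      by (elim exE conjE)
    let ?zs = "map (\<lambda>(x, y). (- x, y)) ys"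
    have neg: "?s (map (\<lambda>(x, y). (- x, y)) ys) + ?s ys \<in> ?G" for ys :: "('b \<times> 'b) list"
    proof (induction ys)
      case (Cons z ys)
      obtain x y where z: "z = (x, y)" by fastforce
      from group_closure.diff[OF tensor_zero_left[of y] tensor_add_left[of "- x" x y UNIV "\<lambda>x c. scale c x" scale]]
      have "frag_of (- x, y) + frag_of (x, y) \<in> ?G"
        by (simp add: add.commute)
      from group_closure_add[OF this Cons.IH] show ?case
        by (simp add: z algebra_simps)
    qed simp
    have "set (xs @ ?zs) \<subseteq> D \<times> D"
      using xs(1) ys(1) subspace_neg[OF D] by auto
    moreover have "(a - ?s xs) - (b - ?s ys) - (?s ?zs + ?s ys) \<in> ?G"
      by (rule group_closure.diff[OF group_closure.diff[OF xs(2) ys(2)] neg])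
    then have "a - b - ?s (xs @ ?zs) \<in> ?G"
      by (simp add: algebra_simps)
    ultimately show ?case
      by blast
  qed
  then obtain xs where xs: "set xs \<subseteq> D \<times> D" "p - ?s xs \<in> ?G"
    by (elim exE conjE)
  show thesis
  proof (rule that[of "\<lambda>i. fst (xs ! i)" "\<lambda>i. snd (xs ! i)" "length xs"])
    show "(p, \<Sum>i<length xs. frag_of (fst (xs ! i), snd (xs ! i))) \<in> rel2"
      using xs(2) by (simp add: tensor_rel_def sum_list_sum_nth atLeast0LessThan)
    show "fst (xs ! i) \<in> D \<and> snd (xs ! i) \<in> D" if "i < length xs" for i
      using xs(1) nth_mem[OF that] by (auto simp: mem_Times_iff)
  qed
qed

end

section \<open>Chosen representatives of the comultiplication\<close>

context coalgebra
begin

lemma comult_class: "p \<in> \<Delta> x \<Longrightarrow> \<Delta> x = rel2 `` {p}"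
  using comult_in[of x] Image_singleton_iff[of _ rel2] equiv_class_eq[OF equiv_rel2]
  unfolding tensor_def by (auto elim!: quotientE)

lemma comult_memI: "\<Delta> x = rel2 `` {p} \<Longrightarrow> p \<in> \<Delta> x"
  using equiv_class_self[OF equiv_rel2] by simp

lemma subcoalgebra_UNIV: "subcoalgebra UNIV"
  using comult_in unfolding subcoalgebra_def tensor_def by (auto elim!: quotientE)

text \<open>A single choice of representatives for the whole coalgebra that restricts to
  \<open>A\<close>: elements of \<open>A\<close> use that \<open>A\<close> is a subcoalgebra, all
  others use the whole space.\<close>

lemma comult_representation:
  assumes A: "subcoalgebra A"
  obtains N :: "'c \<Rightarrow> nat" and l r where "\<forall>x. (\<Sum>i<N x. frag_of (l x i, r x i)) \<in> \<Delta> x"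
    and "\<forall>x\<in>A. \<forall>i<N x. l x i \<in> A \<and> r x i \<in> A"
proof -
  have D: "\<exists>(n::nat) l r. (\<Sum>i<n. frag_of (l i, r i)) \<in> \<Delta> x \<and> (\<forall>i<n. l i \<in> D \<and> r i \<in> D)"
    if "subcoalgebra D" "x \<in> D" for D and x
  proof -
    from that obtain p where p: "\<Delta> x = rel2 `` {p}" "Poly_Mapping.keys p \<subseteq> D \<times> D" and "subspace D"
      unfolding subcoalgebra_def by auto
    obtain l r and n :: nat where sum: "(p, \<Sum>i<n. frag_of (l i, r i)) \<in> rel2"
      and "\<And>i. i < n \<Longrightarrow> l i \<in> D \<and> r i \<in> D"
      by (rule rel2_sum_of_pairs[OF \<open>subspace D\<close> p(2)]) (rule that)
    moreover have "(\<Sum>i<n. frag_of (l i, r i)) \<in> \<Delta> x"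
      using sum p(1) by simp
    ultimately show ?thesis
      by blast
  qed
  let ?good = "\<lambda>x (n :: nat, l, r). (\<Sum>i<n. frag_of (l i, r i)) \<in> \<Delta> x \<and> (x \<in> A \<longrightarrow> (\<forall>i<n. l i \<in> A \<and> r i \<in> A))"
  have "\<exists>t. ?good x t" for x
  proof (cases "x \<in> A")
    case True
    from D[OF A this] obtain n :: nat and l r where "?good x (n, l, r)"
      by auto
    then show ?thesis
      by (rule exI[of "?good x"])
  next
    case False
    from D[OF subcoalgebra_UNIV UNIV_I, of x] obtain n :: nat and l r
      where "(\<Sum>i<n. frag_of (l i, r i)) \<in> \<Delta> x"
      by (elim exE conjE)
    with False have "?good x (n, l, r)"
      by simp
    then show ?thesis
      by (rule exI[of "?good x"])
  qed
  then have "\<exists>t. \<forall>x. ?good x (t x)"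
    by (intro choice allI)
  then obtain t where t: "\<forall>x. ?good x (t x)" ..
  show thesis
    by (rule that[of "\<lambda>x. fst (snd (t x))" "\<lambda>x. snd (snd (t x))" "\<lambda>x. fst (t x)"])
      (use t in \<open>simp_all add: case_prod_unfold\<close>)
qed

end

locale represented_coalgebra = coalgebra scale \<Delta> \<epsilon>
  for scale :: "'k::field \<Rightarrow> 'c::ab_group_add \<Rightarrow> 'c" and \<Delta> \<epsilon> +
  fixes N :: "'c \<Rightarrow> nat" and l r :: "'c \<Rightarrow> nat \<Rightarrow> 'c"
  assumes representation_in: "(\<Sum>i<N x. frag_of (l x i, r x i)) \<in> \<Delta> x"
begin

abbreviation sw :: "('c \<Rightarrow> 'c \<Rightarrow> 'c) \<Rightarrow> 'c \<Rightarrow> 'c"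
  where "sw \<equiv> sweedler_sum N l r"

lemma frag_eval_representation:
  "frag_eval (\<lambda>(u, v). f u v) (\<Sum>i<N x. frag_of (l x i, r x i)) = sweedler_sum N l r f x"
  by (simp add: frag_eval_sum sweedler_sum_def)

text \<open>A bilinear map respects the relators, so the chosen representative may be traded for any
  convenient one. The laws for \<Delta> enter the Sweedler sums this way.\<close>

lemma sw_eq:
  assumes "bilin f" and "p \<in> \<Delta> x"
  shows "sw f x = frag_eval (\<lambda>(u, v). f u v) p"
proof -
  have "(p, \<Sum>i<N x. frag_of (l x i, r x i)) \<in> rel2"
    using representation_in[of x] comult_class[OF assms(2)] by auto
  from frag_eval_rel2[OF assms(1) this] show ?thesis
    by (simp add: frag_eval_representation)
qed

lemma sw_add: "bilin f \<Longrightarrow> sw f (x + y) = sw f x + sw f y"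
proof -
  assume f: "bilin f"
  let ?R = "\<lambda>x. \<Sum>i<N x. frag_of (l x i, r x i)"
  have "?R x + ?R y \<in> \<Delta> (x + y)"
    unfolding comult_add plus2_def using representation_in equiv_class_self[OF equiv_rel2] by blast
  from sw_eq[OF f this] show ?thesis
    by (simp add: frag_eval_add frag_eval_representation)
qed

lemma sw_scale: "bilin f \<Longrightarrow> sw f (scale c x) = scale c (sw f x)"
proof -
  assume f: "bilin f"
  let ?R = "\<Sum>i<N x. frag_of (l x i, r x i)"
  have "frag_extend (\<lambda>(a, b). frag_of (scale c a, id b)) ?R \<in> \<Delta> (scale c x)"
    unfolding comult_scale scale2_def tensor_map_def
    using representation_in equiv_class_self[OF equiv_rel2] by blast
  from sw_eq[OF f this] have "sw f (scale c x) = frag_eval (\<lambda>(a, b). scale c (f a b)) ?R"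
    using f by (simp add: frag_eval_extend case_prod_unfold bilin_def)
  also have "\<dots> = scale c (frag_eval (\<lambda>(a, b). f a b) ?R)"
    by (subst frag_eval_hom[of "scale c"]) (simp_all add: scale_right_distrib case_prod_unfold)
  finally show ?thesis
    by (simp add: frag_eval_representation)
qed

lemma sw_coassoc:
  assumes "trilin F"
  shows "sw (\<lambda>a b. sw (\<lambda>u v. F u v b) a) x = sw (\<lambda>a b. sw (\<lambda>u v. F a u v) b) x"
  using frag_eval_rel3[OF assms coassoc[of "\<lambda>x. \<Sum>i<N x. frag_of (l x i, r x i)", OF representation_in, of x]]
  by (simp add: frag_eval_extend frag_extend_sum frag_eval_sum sweedler_sum_def)

lemma sw_counit_left: "sw (\<lambda>u v. scale (\<epsilon> u) v) x = x"
  using counit_left[OF representation_in, of x]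
  by (simp add: eval_frag_eq frag_eval_representation)

lemma sw_counit_right: "sw (\<lambda>u v. scale (\<epsilon> v) u) x = x"
  using counit_right[OF representation_in, of x]
  by (simp add: eval_frag_eq frag_eval_representation)

lemma sw_zero: "bilin f \<Longrightarrow> sw f 0 = 0"
  using sw_scale[of f 0 0] by simp

text \<open>The chosen representative may have legs outside \<open>D\<close>; it is traded for one
  over \<open>D\<close>, and bilinearity of both maps permits this.\<close>

lemma sw_cong_subcoalgebra:
  assumes "subcoalgebra D" and "x \<in> D" and "bilin f" and "bilin g"
    and "\<And>u v. u \<in> D \<Longrightarrow> v \<in> D \<Longrightarrow> f u v = g u v"
  shows "sw f x = sw g x"
proof -
  obtain p where p: "\<Delta> x = rel2 `` {p}" "Poly_Mapping.keys p \<subseteq> D \<times> D"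
    using assms(1,2) unfolding subcoalgebra_def by auto
  have "frag_eval (\<lambda>(u, v). f u v) p = frag_eval (\<lambda>(u, v). g u v) p"
    unfolding frag_eval_def using p(2) assms(5) by (intro sum.cong) auto
  then show ?thesis
    using assms(3,4) by (simp add: sw_eq[OF _ comult_memI[OF p(1)]])
qed

lemma sw_in_subcoalgebra:
  assumes "subcoalgebra D" and "x \<in> D" and "bilin f" and "subspace V"
    and "\<And>u v. u \<in> D \<Longrightarrow> v \<in> D \<Longrightarrow> f u v \<in> V"
  shows "sw f x \<in> V"
proof -
  obtain p where p: "\<Delta> x = rel2 `` {p}" "Poly_Mapping.keys p \<subseteq> D \<times> D"
    using assms(1,2) unfolding subcoalgebra_def by auto
  show ?thesis
    unfolding sw_eq[OF assms(3) comult_memI[OF p(1)]]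
    by (rule frag_eval_in_subspace[OF assms(4)]) (use p(2) assms(5) in auto)
qed

end

section \<open>Simple components and block projections\<close>

locale cosemisimple_coalgebra = represented_coalgebra +
  assumes cosemisimple: "cosemisimple"
begin

definition is_component :: "'b \<Rightarrow> ('b set \<Rightarrow> 'b) \<Rightarrow> bool"
  where "is_component x d \<longleftrightarrow> (\<forall>D. simple_subcoalgebra D \<longrightarrow> d D \<in> D) \<and>
    (\<forall>D. \<not> simple_subcoalgebra D \<longrightarrow> d D = 0) \<and> finite {D. d D \<noteq> 0} \<and> x = (\<Sum>D | d D \<noteq> 0. d D)"

definition component :: "'b \<Rightarrow> 'b set \<Rightarrow> 'b"
  where "component x = (THE d. is_component x d)"

lemma ex1_component: "\<exists>!d. is_component x d"
  using cosemisimple unfolding cosemisimple_def is_direct_sum_def is_component_def by simp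

lemma is_component_component: "is_component x (component x)"
  unfolding component_def by (rule theI'[OF ex1_component])

lemma component_unique: "is_component x d \<Longrightarrow> component x = d"
  using ex1_component is_component_component by blast

lemma simple_subspace: "simple_subcoalgebra D \<Longrightarrow> subspace D"
  by (simp add: simple_subcoalgebra_def subcoalgebra_def)

lemma component_in: "simple_subcoalgebra D \<Longrightarrow> component x D \<in> D"
  and component_nonsimple: "\<not> simple_subcoalgebra D \<Longrightarrow> component x D = 0"
  and component_finite: "finite {D. component x D \<noteq> 0}"
  and component_sum: "(\<Sum>D | component x D \<noteq> 0. component x D) = x"
  using is_component_component[of x] unfolding is_component_def by auto

lemma component_add: "component (x + y) D = component x D + component y D"
proof -
  let ?d = "\<lambda>D. component x D + component y D"
  let ?U = "{D. component x D \<noteq> 0} \<union> {D. component y D \<noteq> 0}"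
  have U: "finite ?U"
    by (simp add: component_finite)
  have d: "{D. ?d D \<noteq> 0} \<subseteq> ?U"
    by auto
  have "(\<Sum>D | ?d D \<noteq> 0. ?d D) = (\<Sum>D\<in>?U. ?d D)"
    using U d by (intro sum.mono_neutral_left) auto
  also have "\<dots> = (\<Sum>D\<in>?U. component x D) + (\<Sum>D\<in>?U. component y D)"
    by (rule sum.distrib)
  also have "(\<Sum>D\<in>?U. component x D) = (\<Sum>D | component x D \<noteq> 0. component x D)"
    using U by (intro sum.mono_neutral_right) auto
  also have "(\<Sum>D\<in>?U. component y D) = (\<Sum>D | component y D \<noteq> 0. component y D)"
    using U by (intro sum.mono_neutral_right) auto
  finally have "is_component (x + y) ?d"
    using finite_subset[OF d U] unfolding is_component_def
    by (auto simp: component_sum component_nonsimple intro!: subspace_add component_in simple_subspace)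
  then show ?thesis
    by (simp add: component_unique)
qed

lemma component_scale: "component (scale c x) D = scale c (component x D)"
proof -
  let ?d = "\<lambda>D. scale c (component x D)"
  let ?U = "{D. component x D \<noteq> 0}"
  have U: "finite ?U"
    by (simp add: component_finite)
  have d: "{D. ?d D \<noteq> 0} \<subseteq> ?U"
    by auto
  have "(\<Sum>D | ?d D \<noteq> 0. ?d D) = (\<Sum>D\<in>?U. ?d D)"
    using U d by (intro sum.mono_neutral_left) auto
  also have "\<dots> = scale c x"
    by (simp add: scale_sum_right[symmetric] component_sum)
  finally have "is_component (scale c x) ?d"
    using finite_subset[OF d U] unfolding is_component_def
    by (auto simp: component_nonsimple intro!: subspace_scale component_in simple_subspace)
  then show ?thesis
    by (simp add: component_unique)
qed

lemma component_simple:
  assumes "simple_subcoalgebra D" and "x \<in> D"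
  shows "component x D' = (if D' = D then x else 0)"
proof -
  have "{D'. (if D' = D then x else 0) \<noteq> 0} = (if x = 0 then {} else {D})"
    by auto
  then have "is_component x (\<lambda>D'. if D' = D then x else 0)"
    using assms unfolding is_component_def by (auto intro: subspace_0 simple_subspace)
  then show ?thesis
    by (simp add: component_unique)
qed

text \<open>Projection along the simple decomposition onto the blocks in \<open>\<D>\<close>.
  Members of \<open>\<D>\<close> that are not simple contribute 0, so \<open>\<D>\<close> may be
  given as \<open>{D. D \<subseteq> A}\<close>.\<close>

definition block_projection :: "'b set set \<Rightarrow> 'b \<Rightarrow> 'b"
  where "block_projection \<D> x = (\<Sum>D \<in> {D. component x D \<noteq> 0} \<inter> \<D>. component x D)"

lemma block_projection_superset:
  "finite U \<Longrightarrow> {D. component x D \<noteq> 0} \<subseteq> U \<Longrightarrow>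
    block_projection \<D> x = (\<Sum>D \<in> U \<inter> \<D>. component x D)"
  unfolding block_projection_def by (intro sum.mono_neutral_left) auto

lemma block_projection_add: "block_projection \<D> (x + y) = block_projection \<D> x + block_projection \<D> y"
proof -
  let ?U = "{D. component x D \<noteq> 0} \<union> {D. component y D \<noteq> 0} \<union> {D. component (x + y) D \<noteq> 0}"
  have "finite ?U"
    by (simp add: component_finite)
  from block_projection_superset[OF this] show ?thesis
    by (simp add: component_add le_supI1 le_supI2 sum.distrib)
qed

lemma block_projection_scale: "block_projection \<D> (scale c x) = scale c (block_projection \<D> x)"
proof -
  have "block_projection \<D> (scale c x) = (\<Sum>D \<in> {D. component x D \<noteq> 0} \<inter> \<D>. component (scale c x) D)"
    by (rule block_projection_superset) (auto simp: component_finite component_scale)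
  then show ?thesis
    by (simp add: block_projection_def component_scale scale_sum_right)
qed

lemma block_projection_simple:
  assumes "simple_subcoalgebra D" and "x \<in> D"
  shows "block_projection \<D> x = (if D \<in> \<D> then x else 0)"
proof -
  have "block_projection \<D> x = (\<Sum>D' \<in> {D} \<inter> \<D>. component x D')"
    by (rule block_projection_superset) (auto simp: component_simple[OF assms])
  then show ?thesis
    by (auto simp: component_simple[OF assms])
qed

lemma block_projection_in:
  assumes "subspace V" and "\<And>D. D \<in> \<D> \<Longrightarrow> simple_subcoalgebra D \<Longrightarrow> D \<subseteq> V"
  shows "block_projection \<D> x \<in> V"
  unfolding block_projection_def
proof (rule subspace_sum[OF assms(1)])
  fix D
  assume "D \<in> {D. component x D \<noteq> 0} \<inter> \<D>"
  then show "component x D \<in> V"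
    using assms(2)[of D] component_in[of D x] component_nonsimple[of D x] by blast
qed

lemma additive_eqI:
  fixes L L' :: "'b \<Rightarrow> 'w::ab_group_add"
  assumes "\<And>x y. L (x + y) = L x + L y" and "\<And>x y. L' (x + y) = L' x + L' y"
    and eq: "\<And>D x. simple_subcoalgebra D \<Longrightarrow> x \<in> D \<Longrightarrow> L x = L' x"
  shows "L x = L' x"
proof -
  have sum: "M (sum f I) = (\<Sum>i\<in>I. M (f i))" if "\<And>x y. M (x + y) = M x + M y"
    for M :: "'b \<Rightarrow> 'w" and f and I :: "'b set set"
  proof -
    have "M 0 = 0"
      using that[of 0 0] by simp
    then show ?thesis
      by (induction I rule: infinite_finite_induct) (simp_all add: that)
  qed
  have "L (\<Sum>D | component x D \<noteq> 0. component x D) = L' (\<Sum>D | component x D \<noteq> 0. component x D)"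
    unfolding sum[of L, OF assms(1)] sum[of L', OF assms(2)]
  proof (rule sum.cong[OF refl])
    fix D
    assume "D \<in> {D. component x D \<noteq> 0}"
    then show "L (component x D) = L' (component x D)"
      using eq[of D] component_in[of D x] component_nonsimple[of D x] by blast
  qed
  then show ?thesis
    by (simp only: component_sum)
qed

text \<open>On a simple \<open>D\<close> the coproduct stays over \<open>D\<close>, and the
  projection is the identity or zero on all of \<open>D\<close>, hence the same on a leg as on the
  element.\<close>

lemma block_projection_colinear_left:
  assumes f: "bilin f"
  shows "sw (\<lambda>u v. f (block_projection \<D> u) v) x = sw f (block_projection \<D> x)"
proof (rule additive_eqI[where L = "sw (\<lambda>u v. f (block_projection \<D> u) v)"])
  have g: "bilin (\<lambda>u v. f (block_projection \<D> u) v)"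
    using f by (simp add: bilin_def block_projection_add block_projection_scale)
  show "sw (\<lambda>u v. f (block_projection \<D> u) v) (x + y) =
      sw (\<lambda>u v. f (block_projection \<D> u) v) x + sw (\<lambda>u v. f (block_projection \<D> u) v) y" for x y
    by (rule sw_add[OF g])
  show "sw f (block_projection \<D> (x + y)) = sw f (block_projection \<D> x) + sw f (block_projection \<D> y)" for x y
    by (simp add: block_projection_add sw_add[OF f])
  show "sw (\<lambda>u v. f (block_projection \<D> u) v) x = sw f (block_projection \<D> x)"
    if D: "simple_subcoalgebra D" "x \<in> D" for D x
  proof -
    let ?h = "\<lambda>u v. if D \<in> \<D> then f u v else 0"
    have h: "bilin ?h"
      using f by (simp add: bilin_def)
    have "sw (\<lambda>u v. f (block_projection \<D> u) v) x = sw ?h x"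
    proof (rule sw_cong_subcoalgebra[OF _ D(2) g h])
      show "subcoalgebra D"
        using D(1) by (simp add: simple_subcoalgebra_def)
      show "f (block_projection \<D> u) v = ?h u v" if "u \<in> D" for u v
        using f scale_zero_left[of u] by (simp add: block_projection_simple[OF D(1) that] bilin_def) (metis scale_zero_left)
    qed
    moreover have "sw (\<lambda>u v. 0) x = 0"
      by (simp add: sweedler_sum_def)
    ultimately show ?thesis
      by (simp add: block_projection_simple[OF D] sw_zero[OF f])
  qed
qed

lemma block_projection_colinear_right:
  assumes f: "bilin f"
  shows "sw (\<lambda>u v. f u (block_projection \<D> v)) x = sw f (block_projection \<D> x)"
proof (rule additive_eqI[where L = "sw (\<lambda>u v. f u (block_projection \<D> v))"])
  have g: "bilin (\<lambda>u v. f u (block_projection \<D> v))"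
    using f by (simp add: bilin_def block_projection_add block_projection_scale)
  show "sw (\<lambda>u v. f u (block_projection \<D> v)) (x + y) =
      sw (\<lambda>u v. f u (block_projection \<D> v)) x + sw (\<lambda>u v. f u (block_projection \<D> v)) y" for x y
    by (rule sw_add[OF g])
  show "sw f (block_projection \<D> (x + y)) = sw f (block_projection \<D> x) + sw f (block_projection \<D> y)" for x y
    by (simp add: block_projection_add sw_add[OF f])
  show "sw (\<lambda>u v. f u (block_projection \<D> v)) x = sw f (block_projection \<D> x)"
    if D: "simple_subcoalgebra D" "x \<in> D" for D x
  proof -
    let ?h = "\<lambda>u v. if D \<in> \<D> then f u v else 0"
    have h: "bilin ?h"
      using f by (simp add: bilin_def)
    have "sw (\<lambda>u v. f u (block_projection \<D> v)) x = sw ?h x"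
    proof (rule sw_cong_subcoalgebra[OF _ D(2) g h])
      show "subcoalgebra D"
        using D(1) by (simp add: simple_subcoalgebra_def)
      show "f u (block_projection \<D> v) = ?h u v" if "v \<in> D" for u v
        using f scale_zero_left[of u] by (simp add: block_projection_simple[OF D(1) that] bilin_def) (metis scale_zero_left)
    qed
    moreover have "sw (\<lambda>u v. 0) x = 0"
      by (simp add: sweedler_sum_def)
    ultimately show ?thesis
      by (simp add: block_projection_simple[OF D] sw_zero[OF f])
  qed
qed

text \<open>By the counit and colinearity, P a = \<epsilon>(P a_1) a_2, where the legs can be taken
  in \<open>A\<close>.\<close>

lemma block_projection_subcoalgebra:
  assumes A: "subcoalgebra A" and "a \<in> A"
  shows "block_projection \<D> a \<in> A"
proof -
  have f: "bilin (\<lambda>u v. scale (\<epsilon> u) v)"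
    by (simp add: bilin_def counit_add counit_scale scale_left_distrib scale_right_distrib mult.commute)
  have g: "bilin (\<lambda>u v. scale (\<epsilon> (block_projection \<D> u)) v)"
    by (simp add: bilin_def block_projection_add block_projection_scale counit_add counit_scale
        scale_left_distrib scale_right_distrib mult.commute)
  have "subspace A"
    using A by (simp add: subcoalgebra_def)
  then have "sw (\<lambda>u v. scale (\<epsilon> (block_projection \<D> u)) v) a \<in> A"
    using A \<open>a \<in> A\<close> by (intro sw_in_subcoalgebra[OF A _ g] subspace_scale)
  then show ?thesis
    using block_projection_colinear_left[OF f] by (simp add: sw_counit_left)
qed

text \<open>The projection to \<open>D\<close> maps \<open>A\<close> into itself, so the component
  is a nonzero element of A \<inter> D. This intersection is a subcoalgebra, and simplicity of
  \<open>D\<close> makes it all of \<open>D\<close>.\<close>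

lemma component_subcoalgebra:
  assumes A: "subcoalgebra A" and "a \<in> A" and "component a D \<noteq> 0"
  shows "D \<subseteq> A"
proof -
  have D: "simple_subcoalgebra D"
    using assms(3) component_nonsimple by blast
  then have subco: "subcoalgebra D"
    by (simp add: simple_subcoalgebra_def)
  let ?P = "block_projection {D}"
  have P_D: "?P x \<in> D" for x
    using simple_subspace[OF D] by (rule block_projection_in) simp
  have "?P a = component a D"
    using assms(3) by (simp add: block_projection_def)
  then have "component a D \<in> A"
    using block_projection_subcoalgebra[OF A \<open>a \<in> A\<close>, of "{D}"] by simp
  then have nonzero: "A \<inter> D \<noteq> {0}"
    using assms(3) component_in[OF D] by blast
  have "subcoalgebra (A \<inter> D)"
    unfolding subcoalgebra_def
  proof (intro conjI ballI)
    show "subspace (A \<inter> D)"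
      using A simple_subspace[OF D] by (intro subspace_inter) (simp add: subcoalgebra_def)
    fix x
    assume x: "x \<in> A \<inter> D"
    obtain p where p: "\<Delta> x = rel2 `` {p}" "Poly_Mapping.keys p \<subseteq> A \<times> A"
      using A x unfolding subcoalgebra_def by auto
    obtain q where q: "\<Delta> x = rel2 `` {q}" "Poly_Mapping.keys q \<subseteq> D \<times> D"
      using subco x unfolding subcoalgebra_def by auto
    \<comment> \<open>P \<otimes> P fixes the representative \<open>q\<close> over \<open>D\<close>
      and carries \<open>p\<close>, which lies over \<open>A\<close>, to one over A \<inter> D; both
      represent the same class.\<close>
    let ?PP = "frag_extend (\<lambda>(u, v). frag_of (?P u, ?P v))"
    have "?PP q = frag_extend frag_of q"
      using q(2) by (intro frag_extend_eq) (auto simp: block_projection_simple[OF D])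
    then have "?PP q = q"
      by (simp add: frag_expansion[symmetric])
    moreover have "(p, q) \<in> rel2"
      using comult_memI[OF q(1)] p(1) by auto
    then have "(?PP p, ?PP q) \<in> rel2"
      by (rule frag_extend_rel2[OF block_projection_add block_projection_scale])
    ultimately have "\<Delta> x = rel2 `` {?PP p}"
      using q(1) equiv_class_eq[OF equiv_rel2] by metis
    moreover have "Poly_Mapping.keys (?PP p) \<subseteq> (A \<inter> D) \<times> (A \<inter> D)"
      using keys_frag_extend[of "\<lambda>(u, v). frag_of (?P u, ?P v)" p] p(2) P_D
        block_projection_subcoalgebra[OF A, of _ "{D}"]
      by (fastforce simp: keys_frag_of)
    ultimately show "\<Delta> x \<in> {rel2 `` {p} | p. Poly_Mapping.keys p \<subseteq> (A \<inter> D) \<times> (A \<inter> D)}"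
      by blast
  qed
  then have "A \<inter> D = D"
    using D nonzero unfolding simple_subcoalgebra_def by blast
  then show ?thesis
    by blast
qed

lemma block_projection_id:
  assumes "subcoalgebra A" and "a \<in> A"
  shows "block_projection {D. D \<subseteq> A} a = a"
proof -
  have "{D. component a D \<noteq> 0} \<inter> {D. D \<subseteq> A} = {D. component a D \<noteq> 0}"
    using component_subcoalgebra[OF assms] by blast
  then show ?thesis
    by (simp add: block_projection_def component_sum)
qed

end

section \<open>Cosemisimple Hopf algebras and the conclusion\<close>

context hopf_algebra
begin

lemma cosemisimple_sweedler_hopf:
  assumes "cosemisimple" and A: "hopf_subalgebra A"
  obtains N l r E where "sweedler_hopf scale N l r (*) 1 \<epsilon> S A E"
proof -
  have subco: "subcoalgebra A" and "subspace A"
    using A by (simp_all add: hopf_subalgebra_def subcoalgebra_def)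
  obtain N :: "'h \<Rightarrow> nat" and l r where "\<forall>x. (\<Sum>i<N x. frag_of (l x i, r x i)) \<in> \<Delta> x"
    and rep_A: "\<forall>x\<in>A. \<forall>i<N x. l x i \<in> A \<and> r x i \<in> A"
    by (rule comult_representation[OF subco]) (rule that)
  then have rep: "(\<Sum>i<N x. frag_of (l x i, r x i)) \<in> \<Delta> x" for x
    by blast
  interpret cosemisimple_coalgebra scale \<Delta> \<epsilon> N l r
    using rep assms(1) by unfold_locales
  \<comment> \<open>The projection onto the sum of the simple subcoalgebras inside \<open>A\<close>;
    it fixes \<open>A\<close> because every block occurring in an element of \<open>A\<close> lies
    in \<open>A\<close>.\<close>
  let ?E = "block_projection {D. D \<subseteq> A}"
  have mult: "sw f (x * y) = sw (\<lambda>a b. sw (\<lambda>c d. f (a * c) (b * d)) y) x" if f: "bilin f" for f x y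
  proof -
    have "frag_extend (\<lambda>(a, b). frag_extend (\<lambda>(c, d). frag_of (a * c, b * d))
        (\<Sum>i<N y. frag_of (l y i, r y i))) (\<Sum>i<N x. frag_of (l x i, r x i)) \<in> \<Delta> (x * y)"
      unfolding comult_mult using rep equiv_class_self[OF equiv_rel2] by blast
    from sw_eq[OF f this] show ?thesis
      by (simp add: frag_extend_sum frag_eval_sum sweedler_sum_def)
  qed
  have "sweedler_hopf scale N l r (*) 1 \<epsilon> S A ?E"
  proof unfold_locales
    show "bilin (*)"
      by (simp add: bilin_def scale_mult_left scale_mult_right distrib_left distrib_right)
    show "sw (\<lambda>u v. S u * v) x = scale (\<epsilon> x) 1" for x
      using antipode_left[OF rep] by (simp add: eval_frag_eq frag_eval_representation)
    show "sw (\<lambda>u v. u * S v) x = scale (\<epsilon> x) 1" for x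
      using antipode_right[OF rep] by (simp add: eval_frag_eq frag_eval_representation)
    show "?E x \<in> A" for x
      using \<open>subspace A\<close> by (rule block_projection_in) simp
    show "1 \<in> A" "\<And>a b. a \<in> A \<Longrightarrow> b \<in> A \<Longrightarrow> a * b \<in> A" "\<And>a. a \<in> A \<Longrightarrow> S a \<in> A"
      using A by (simp_all add: hopf_subalgebra_def)
  qed (fact mult.assoc mult_1_left mult_1_right counit_add counit_scale counit_mult antipode_add antipode_scale
      sw_add sw_scale sw_coassoc sw_counit_left sw_counit_right mult \<open>subspace A\<close>
      block_projection_add block_projection_scale block_projection_id[OF subco]
      block_projection_colinear_left block_projection_colinear_right
    | use rep_A in blast)+
  then show thesis
    by (rule that)
qed

end

theorem theorem2p1:
  fixes scale :: "'k::field \<Rightarrow> 'h::ring_1 \<Rightarrow> 'h"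
    and \<Delta> :: "'h \<Rightarrow> ('h \<times> 'h \<Rightarrow>\<^sub>0 int) set"
    and \<epsilon> :: "'h \<Rightarrow> 'k"
    and S :: "'h \<Rightarrow> 'h"
    and A :: "'h set"
  assumes "hopf_algebra scale \<Delta> \<epsilon> S"
    and "coalgebra.cosemisimple scale \<Delta>"
    and "hopf_algebra.hopf_subalgebra scale \<Delta> S A"
  shows "faithfully_flat_right
           TYPE('m1::ab_group_add) TYPE('m2::ab_group_add) TYPE('m3::ab_group_add)
           A (\<lambda>h a. h * a) \<and>
         faithfully_flat_left
           TYPE('m1::ab_group_add) TYPE('m2::ab_group_add) TYPE('m3::ab_group_add)
           A (\<lambda>a h. a * h)"
proof -
  interpret hopf_algebra scale \<Delta> \<epsilon> S
    by fact
  obtain N l r E where H: "sweedler_hopf scale N l r (*) 1 \<epsilon> S A E"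
    by (rule cosemisimple_sweedler_hopf[OF assms(2,3)])
  obtain \<phi> where "dual_basis_module A (*) 1 (*) \<phi> E 1"
    by (rule sweedler_hopf.dual_basis_module[OF H])
  moreover have "right_module A (*)"
    by (simp add: right_module_def distrib_left distrib_right mult.assoc)
  \<comment> \<open>The mirror instance has the reversed product, so its dual basis belongs to H as
    a left module.\<close>
  moreover obtain \<psi> where "dual_basis_module A (\<lambda>x y. y * x) 1 (\<lambda>x y. y * x) \<psi> E 1"
    by (rule sweedler_hopf.dual_basis_module[OF sweedler_hopf.mirror[OF H]])
  moreover have "left_module A (*)"
    by (simp add: left_module_def distrib_left distrib_right mult.assoc)
  ultimately show ?thesis
    by (blast intro: faithfully_flat_rightI faithfully_flat_leftI)
qed

end
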